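(* Let $n\ge 1$ and let $\lambda=(\lambda_1,\dots,\lambda_l)$ and $\mu=(\mu_1,\dots,\mu_m)$ be strict partitions of $n$. Then $$L_{\lambda\mu}(t)=\sum_{i:\ \lambda_i\ge\mu_1}\ \sum_{\xi}(-1)^{i-1}\,2^{a(\xi/\lambda^{\hat{i}})}\,t^{\lambda_i-\mu_1}\,L_{\xi\,\mu^{\hat{1}}}(t),$$ where the outer sum is over indices $1\le i\le l$ with $\lambda_i\ge\mu_1$, and the inner sum is over strict partitions $\xi\supset\lambda^{\hat{i}}$ such that $\xi/\lambda^{\hat{i}}$ is a horizontal strip with $\lambda_i-\mu_1$ boxes.
   Context: A strict partition is a finite strictly decreasing sequence of positive integers (possibly empty); partitions are identified with their Young diagrams, and $l(\lambda)$ denotes the number of nonzero parts. For $\lambda=(\lambda_1,\dots,\lambda_l)$, $\lambda^{\hat{i}}=(\lambda_1,\dots,\lambda_{i-1},\lambda_{i+1},\dots,\lambda_l)$ is $\lambda$ with its $i$-th part removed. A skew diagram $\xi/\nu$ (with $\nu\subset\xi$) is a horizontal strip if each column contains at most one box of it (the empty skew diagram, with $0$ boxes, is allowed). For a horizontal strip $\xi/\nu$ between strict partitions, $a(\xi/\nu)$ is the number of integers $j\ge1$ such that $\xi/\nu$ has a box in column $j$ but none in column $j+1$ (ordinary, unshifted diagrams). Let $\Gamma=\mathbb{C}(t)[p_1,p_3,p_5,\dots]$ be the polynomial ring over $\mathbb{C}(t)$ in the odd power sums, with unit $\mathbbm{1}$ ("vacuum vector"). Define operators $Q_n,G_n$ ($n\in\mathbb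 Z$) on $\Gamma$ by $$Q(z)=\exp\Big(\sum_{n\ge1\text{ odd}}\tfrac{2}{n}p_nz^n\Big)\exp\Big(-\sum_{n\ge1\text{ odd}}\tfrac{\partial}{\partial p_n}z^{-n}\Big)=\sum_{n\in\mathbb Z}Q_nz^n,$$ $$G(z)=\exp\Big(\sum_{n\ge1\text{ odd}}\tfrac{2}{n}p_nz^n\Big)\exp\Big(\sum_{n\ge1\text{ odd}}(t^n-1)\tfrac{\partial}{\partial p_n}z^{-n}\Big)=\sum_{n\in\mathbb Z}G_nz^n.$$ For a strict partition $\lambda=(\lambda_1,\dots,\lambda_l)$, Schur's $Q$-function is $Q_\lambda=Q_{\lambda_1}\cdots Q_{\lambda_l}.\mathbbm{1}$, and the $Q$-Hall-Littlewood function is $G_\lambda(x;t)=G_{\lambda_1}\cdots G_{\lambda_l}.\mathbbm{1}$ (equivalently $G_\lambda(x;t)=\prod_{i<j}\frac{1+tR_{ij}}{1-tR_{ij}}Q_\lambda$ with the usual raising operators $R_{ij}$ acting on the index). The $Q_\lambda$, $\lambda$ strict, form a basis of $\Gamma$. The $Q$-Kostka polynomials $L_{\lambda\mu}(t)$ ($\lambda,\mu$ strict) are defined by $G_\mu(x;t)=\sum_{\lambda\text{ strict}}L_{\lambda\mu}(t)Q_\lambda$; in particular $L_{\emptyset\emptyset}=1$ and $L_{\lambda\mu}=0$ if $|\lambda|\ne|\mu|$. *)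

theory Defs
  imports
    "HOL-Library.Poly_Mapping"
    "HOL-Computational_Algebra.Polynomial"
    "HOL-Computational_Algebra.Fraction_Field"
    "HOL-Computational_Algebra.Formal_Power_Series"
begin

section \<open>The ring of odd power sums over the rational functions\<close>

type_synonym ratfun = "complex poly fract"

definition t :: ratfun
  where "t = Fraction_Field.Fract [:0, 1:] 1"

text \<open>
  Monomials are finitely supported exponent functions. The exponent at index \<open>k\<close> is that of
  the odd power sum of degree \<open>2 * k + 1\<close>, so the whole type is the polynomial ring and
  the degree \<open>n\<close> power sum (\<open>n\<close> odd) has index \<open>n div 2\<close>.
\<close>

type_synonym monom_p = "nat \<Rightarrow>\<^sub>0 nat"

type_synonym gamma = "monom_p \<Rightarrow>\<^sub>0 ratfun"

definition smul :: "ratfun \<Rightarrow> gamma \<Rightarrow> gamma"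
  where "smul c f = Poly_Mapping.single 0 c * f"

definition psum :: "nat \<Rightarrow> gamma"
  where "psum n = Poly_Mapping.single (Poly_Mapping.single (n div 2) 1) 1"

definition d_psum :: "nat \<Rightarrow> gamma \<Rightarrow> gamma"
  where "d_psum n f =
    (\<Sum>m\<in>Poly_Mapping.keys f.
       Poly_Mapping.single (m - Poly_Mapping.single (n div 2) 1)
         (of_nat (Poly_Mapping.lookup m (n div 2)) * Poly_Mapping.lookup f m))"


section \<open>Vertex operators\<close>

text \<open>
  Exponential of a power series without constant term: the \<open>j\<close>-th power contributes to the
  \<open>k\<close>-th coefficient only for \<open>j \<le> k\<close>.
\<close>

definition gamma_fps_exp :: "gamma fps \<Rightarrow> gamma fps"
  where "gamma_fps_exp F =
    Abs_fps (\<lambda>k. \<Sum>j\<le>k. smul (1 / of_nat (fact j)) (fps_nth (F ^ j) k))"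

text \<open>The coefficients of \<open>exp (\<Sum> (2 / n) p\<^sub>n z\<^sup>n)\<close>, the sum being over odd \<open>n\<close>.\<close>

definition creation_part :: "gamma fps"
  where "creation_part =
    gamma_fps_exp (Abs_fps (\<lambda>n. if odd n then smul (2 / of_nat n) (psum n) else 0))"

text \<open>
  The operator \<open>\<Sum> c\<^sub>n (\<partial> / \<partial> p\<^sub>n) w\<^sup>n\<close> (sum over odd \<open>n\<close>), acting on power series in
  \<open>w\<close> with coefficients in the ring; \<open>w\<close> stands for the inverse of \<open>z\<close>.
\<close>

definition deriv_series :: "(nat \<Rightarrow> ratfun) \<Rightarrow> gamma fps \<Rightarrow> gamma fps"
  where "deriv_series c F =
    Abs_fps (\<lambda>k. \<Sum>n | odd n \<and> n \<le> k. smul (c n) (d_psum n (fps_nth F (k - n))))"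

text \<open>
  The coefficient of \<open>w\<^sup>k\<close> in the exponential of that operator, applied to \<open>f\<close>. The operator
  raises the order in \<open>w\<close>, so again only the powers \<open>j \<le> k\<close> contribute.
\<close>

definition annihilation_part :: "(nat \<Rightarrow> ratfun) \<Rightarrow> nat \<Rightarrow> gamma \<Rightarrow> gamma"
  where "annihilation_part c k f =
    (\<Sum>j\<le>k. smul (1 / of_nat (fact j)) (fps_nth ((deriv_series c ^^ j) (fps_const f)) k))"

text \<open>
  The coefficient of \<open>z\<^sup>n\<close> in
  \<open>exp (\<Sum> (2 / n) p\<^sub>n z\<^sup>n) exp (\<Sum> c\<^sub>n (\<partial> / \<partial> p\<^sub>n) z\<^bsup>-n\<^esup>)\<close>, applied to \<open>f\<close>. Only finitely
  many summands are nonzero, as \<open>annihilation_part c k\<close> lowers the weighted degree by \<open>k\<close>.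
\<close>

definition vertex_op :: "(nat \<Rightarrow> ratfun) \<Rightarrow> int \<Rightarrow> gamma \<Rightarrow> gamma"
  where "vertex_op c n f =
    Sum_any (\<lambda>k::nat. if n + int k \<ge> 0
      then fps_nth creation_part (nat (n + int k)) * annihilation_part c k f else 0)"

definition Q_op :: "int \<Rightarrow> gamma \<Rightarrow> gamma"
  where "Q_op = vertex_op (\<lambda>n. - 1)"

definition G_op :: "int \<Rightarrow> gamma \<Rightarrow> gamma"
  where "G_op = vertex_op (\<lambda>n. t ^ n - 1)"

definition schur_Q :: "nat list \<Rightarrow> gamma"
  where "schur_Q lam = foldr (\<lambda>n. Q_op (int n)) lam 1"

definition hall_littlewood_G :: "nat list \<Rightarrow> gamma"
  where "hall_littlewood_G mu = foldr (\<lambda>n. G_op (int n)) mu 1"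


section \<open>Strict partitions and horizontal strips\<close>

definition strict_partition :: "nat list \<Rightarrow> bool"
  where "strict_partition lam \<longleftrightarrow> sorted_wrt (>) lam \<and> 0 \<notin> set lam"

text \<open>Parts, rows and columns are numbered from 1.\<close>

definition part :: "nat list \<Rightarrow> nat \<Rightarrow> nat"
  where "part lam i = lam ! (i - 1)"

definition remove_part :: "nat \<Rightarrow> nat list \<Rightarrow> nat list"
  where "remove_part i lam = take (i - 1) lam @ drop i lam"

definition diagram :: "nat list \<Rightarrow> (nat \<times> nat) set"
  where "diagram lam = {(i, j). 1 \<le> i \<and> i \<le> length lam \<and> 1 \<le> j \<and> j \<le> part lam i}"

definition skew_diagram :: "nat list \<Rightarrow> nat list \<Rightarrow> (nat \<times> nat) set"
  where "skew_diagram xi nu = diagram xi - diagram nu"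

definition horizontal_strip :: "nat list \<Rightarrow> nat list \<Rightarrow> bool"
  where "horizontal_strip xi nu \<longleftrightarrow>
    diagram nu \<subseteq> diagram xi \<and> (\<forall>j. card {i. (i, j) \<in> skew_diagram xi nu} \<le> 1)"

definition strip_a :: "nat list \<Rightarrow> nat list \<Rightarrow> nat"
  where "strip_a xi nu =
    card {j. j \<ge> 1 \<and> (\<exists>i. (i, j) \<in> skew_diagram xi nu) \<and>
             \<not> (\<exists>i. (i, j + 1) \<in> skew_diagram xi nu)}"


section \<open>Q-Kostka polynomials\<close>

text \<open>
  The coefficients of \<open>hall_littlewood_G mu\<close> in the basis of the \<open>schur_Q lam\<close>, \<open>lam\<close> strict.
  The finitely supported family \<open>L\<close> is unique because these elements form a basis.
\<close>

definition Q_Kostka :: "nat list \<Rightarrow> nat list \<Rightarrow> ratfun"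
  where "Q_Kostka lam mu =
    Poly_Mapping.lookup
      (THE L :: nat list \<Rightarrow>\<^sub>0 ratfun.
         (\<forall>nu\<in>Poly_Mapping.keys L. strict_partition nu) \<and>
         hall_littlewood_G mu =
           (\<Sum>nu\<in>Poly_Mapping.keys L. smul (Poly_Mapping.lookup L nu) (schur_Q nu)))
      lam"

end

theory Submission
  imports Defs
begin

text \<open>
  With \<open>A(w) = exp (\<Sum> (\<partial> / \<partial> p\<^sub>n) w\<^sup>n)\<close>, which is a family of Hasse derivations, the vertex operators
  are related by \<open>G\<^sub>n = \<Sum> t\<^sup>k Q\<^bsub>n+k\<^esub> A\<^sub>k\<close>. Hence the coefficient of \<open>Q\<^sub>\<lambda>\<close> in \<open>G\<^sub>\<mu>\<close> is obtained by first
  applying \<open>A\<^sub>k\<close> to \<open>G\<close> of the remaining parts of \<open>\<mu>\<close> and then \<open>Q\<^sub>a\<close> with \<open>a = \<mu>\<^sub>1 + k\<close>.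
  As the \<open>Q\<^sub>n\<close> anticommute, applying \<open>Q\<^sub>a\<close> inserts the part \<open>a\<close> with a sign, which yields the
  outer sum over the parts \<open>\<lambda>\<^sub>i \<ge> \<mu>\<^sub>1\<close>. The coefficient of \<open>Q\<^sub>\<nu>\<close> in \<open>A\<^sub>k Q\<^sub>\<xi>\<close> is \<open>2\<^bsup>a(\<xi>/\<nu>)\<^esup>\<close> for a
  horizontal strip with \<open>k\<close> boxes and \<open>0\<close> otherwise: the relation
  \<open>A\<^sub>k Q\<^sub>n = A\<^bsub>k-1\<^esub> Q\<^bsub>n-1\<^esub> + Q\<^sub>n A\<^sub>k + Q\<^bsub>n-1\<^esub> A\<^bsub>k-1\<^esub>\<close> gives a recursion for it that builds the strip row by
  row. The same relation shows that the \<open>Q\<^sub>\<lambda>\<close> are independent, since \<open>A\<^sub>k\<close> with \<open>k\<close> the largest part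
  removes that part from \<open>Q\<^sub>\<lambda>\<close> and kills all \<open>Q\<^sub>\<lambda>\<close> with smaller parts.
\<close>


section \<open>Polynomials in the odd power sums\<close>

text \<open>The exponentials divide by factorials and by odd integers. Characteristic 0 is what
  allows such factors to be cancelled.\<close>

instance fract :: ("{idom, semiring_char_0}") field_char_0
proof
  show "inj (of_nat :: nat \<Rightarrow> 'a fract)"
    by (rule injI) (simp add: of_nat_fract eq_fract)
qed

lemma smul_add_right: "smul c (f + g) = smul c f + smul c g"
  by (simp add: smul_def distrib_left)

lemma smul_add_left: "smul (a + b) f = smul a f + smul b f"
  by (simp add: smul_def single_add distrib_right)

lemma smul_smul: "smul a (smul b f) = smul (a * b) f"
  by (simp only: smul_def mult.assoc [symmetric] mult_single add_0)

lemma smul_one [simp]: "smul 1 f = f"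
  by (simp add: smul_def)

lemma smul_zero_left [simp]: "smul 0 f = 0"
  by (simp add: smul_def)

lemma smul_zero_right [simp]: "smul c 0 = 0"
  by (simp add: smul_def)

lemma smul_mult_left: "smul c f * g = smul c (f * g)"
  by (simp add: smul_def mult.assoc)

lemma smul_mult_right: "f * smul c g = smul c (f * g)"
  by (simp add: smul_def mult.left_commute)

lemma smul_sum: "smul c (\<Sum>x\<in>A. f x) = (\<Sum>x\<in>A. smul c (f x))"
  by (simp add: smul_def sum_distrib_left)

lemma smul_of_nat: "smul (of_nat n) f = of_nat n * f"
  by (simp add: smul_def)

lemma smul_uminus_left: "smul (- c) f = - smul c f"
  by (simp add: smul_def single_uminus)

lemma lookup_smul: "Poly_Mapping.lookup (smul c f) m = c * Poly_Mapping.lookup f m"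
  by (simp add: smul_def map.rep_eq when_def flip: mult_map_scale_conv_mult)

lemma poly_mapping_single_induct [case_names zero single add]:
  fixes f :: "'a \<Rightarrow>\<^sub>0 'b::ab_group_add"
  assumes "P 0" "\<And>m v. P (Poly_Mapping.single m v)"
    "\<And>f g. P f \<Longrightarrow> P g \<Longrightarrow> P (f + g)"
  shows "P f"
proof (induction f rule: update_induct)
  case const then show ?case using assms(1) by simp
next
  case (update f a b)
  have "Poly_Mapping.update a b f = f + Poly_Mapping.single a b"
    using update by (intro poly_mapping_eqI)
      (auto simp: lookup_update lookup_add lookup_single when_def in_keys_iff)
  then show ?case using assms update by metis
qed

text \<open>Only the monomial \<open>m + e\<close>, with \<open>e\<close> the exponent of the
  variable, contributes. The definition sums over the support, which changes under addition; this
  coefficientwise form makes linearity immediate.\<close>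

lemma lookup_d_psum:
  "Poly_Mapping.lookup (d_psum n f) m =
    of_nat (Poly_Mapping.lookup m (n div 2) + 1) *
    Poly_Mapping.lookup f (m + Poly_Mapping.single (n div 2) 1)"
proof -
  define e where "e = (Poly_Mapping.single (n div 2) 1 :: monom_p)"
  have e1: "Poly_Mapping.lookup e (n div 2) = 1"
    by (simp add: e_def)
  have eq: "Poly_Mapping.lookup (Poly_Mapping.single (k - e)
      (of_nat (Poly_Mapping.lookup k (n div 2)) * Poly_Mapping.lookup f k)) m
    = (if k = m + e then of_nat (Poly_Mapping.lookup m (n div 2) + 1) * Poly_Mapping.lookup f (m + e) else 0)" for k
  proof (cases "k = m + e")
    case True
    then show ?thesis by (simp add: lookup_add e1)
  next
    case False
    show ?thesis
    proof (cases "k - e = m")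
      case True
      \<comment> \<open>Subtraction of exponents is truncated, so \<open>k - e = m\<close> gives
        \<open>k = m + e\<close> only if the variable occurs in \<open>k\<close>; otherwise the
        coefficient is 0.\<close>
      have "Poly_Mapping.lookup k (n div 2) = 0"
      proof (rule ccontr)
        assume nz: "Poly_Mapping.lookup k (n div 2) \<noteq> 0"
        have "k = (k - e) + e"
          using nz by (intro poly_mapping_eqI)
            (auto simp: lookup_add lookup_minus e_def lookup_single when_def)
        with True False show False by simp
      qed
      with False True show ?thesis by simp
    next
      case neq: False
      then show ?thesis using False by (simp add: lookup_single when_def)
    qed
  qed
  have "Poly_Mapping.lookup (d_psum n f) m =
    (\<Sum>k\<in>Poly_Mapping.keys f. (if k = m + e then of_nat (Poly_Mapping.lookup m (n div 2) + 1) * Poly_Mapping.lookup f (m + e) else 0))"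
    unfolding d_psum_def lookup_sum e_def[symmetric] eq ..
  also have "\<dots> = of_nat (Poly_Mapping.lookup m (n div 2) + 1) * Poly_Mapping.lookup f (m + e)"
    by (simp add: sum.delta in_keys_iff)
  finally show ?thesis by (simp add: e_def)
qed

lemma d_psum_add: "d_psum n (f + g) = d_psum n f + d_psum n g"
  by (intro poly_mapping_eqI) (simp add: lookup_d_psum lookup_add distrib_left)

lemma d_psum_smul: "d_psum n (smul c f) = smul c (d_psum n f)"
  by (intro poly_mapping_eqI) (simp add: lookup_d_psum lookup_smul mult.left_commute)

lemma d_psum_zero [simp]: "d_psum n 0 = 0"
  by (simp add: d_psum_def)

lemma d_psum_sum: "d_psum n (\<Sum>x\<in>A. f x) = (\<Sum>x\<in>A. d_psum n (f x))"
  by (induction A rule: infinite_finite_induct) (auto simp: d_psum_add)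

lemma d_psum_single: "d_psum n (Poly_Mapping.single m v) =
  Poly_Mapping.single (m - Poly_Mapping.single (n div 2) 1) (of_nat (Poly_Mapping.lookup m (n div 2)) * v)"
  by (cases "v = 0") (simp_all add: d_psum_def)

lemma d_psum_const [simp]: "d_psum n (Poly_Mapping.single 0 s) = 0"
  by (simp add: d_psum_single)

lemma d_psum_psum: "odd n \<Longrightarrow> odd m \<Longrightarrow> d_psum n (psum m) = (if n = m then 1 else 0)"
proof -
  assume "odd n" "odd m"
  then have "n div 2 = m div 2 \<longleftrightarrow> n = m" by (metis odd_two_times_div_two_succ)
  then show ?thesis
    by (auto simp: psum_def d_psum_single lookup_single)
qed

lemma d_psum_mult_single:
  "d_psum n (Poly_Mapping.single m v * Poly_Mapping.single k w) =
   d_psum n (Poly_Mapping.single m v) * Poly_Mapping.single k w +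
   Poly_Mapping.single m v * d_psum n (Poly_Mapping.single k w)"
proof -
  define e where "e = (Poly_Mapping.single (n div 2) 1 :: monom_p)"
  \<comment> \<open>Truncation is harmless when the variable occurs in \<open>m\<close>. Otherwise
    the two monomials may differ, but their coefficient is 0.\<close>
  have *: "(m + k) - e = (m - e) + k" if "Poly_Mapping.lookup m (n div 2) \<noteq> 0" for m k :: monom_p
    using that by (intro poly_mapping_eqI) (auto simp: lookup_add lookup_minus e_def lookup_single when_def)
  have 1: "Poly_Mapping.single (m + k - e) (of_nat (Poly_Mapping.lookup m (n div 2)) * (v * w)) =
        Poly_Mapping.single (m - e + k) (of_nat (Poly_Mapping.lookup m (n div 2)) * (v * w))"
    using *[of m k] by (cases "Poly_Mapping.lookup m (n div 2) = 0") auto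
  have 2: "Poly_Mapping.single (m + k - e) (of_nat (Poly_Mapping.lookup k (n div 2)) * (v * w)) =
        Poly_Mapping.single (m + (k - e)) (of_nat (Poly_Mapping.lookup k (n div 2)) * (v * w))"
    using *[of k m] by (cases "Poly_Mapping.lookup k (n div 2) = 0") (auto simp: add.commute)
  show ?thesis
    unfolding mult_single d_psum_single e_def[symmetric]
    using 1 2 by (simp add: lookup_add distrib_right distrib_left single_add mult.left_commute mult.assoc)
qed

lemma d_psum_mult: "d_psum n (f * g) = d_psum n f * g + f * d_psum n g"
proof (induction f rule: poly_mapping_single_induct)
  case (single m v)
  show ?case
    by (induction g rule: poly_mapping_single_induct)
      (simp_all add: d_psum_mult_single d_psum_add algebra_simps)
qed (simp_all add: d_psum_add algebra_simps)

text \<open>The ring is generated over the scalars by the odd power sums, so identities between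
  families of operators that obey a product rule reduce to the generators.\<close>

lemma gamma_induct [case_names const psum add mult]:
  fixes f :: gamma
  assumes c: "\<And>c. P (Poly_Mapping.single 0 c)" and psum: "\<And>n. odd n \<Longrightarrow> P (psum n)"
    and add: "\<And>f g. P f \<Longrightarrow> P g \<Longrightarrow> P (f + g)" and mult: "\<And>f g. P f \<Longrightarrow> P g \<Longrightarrow> P (f * g)"
  shows "P f"
proof -
  have i: "P (Poly_Mapping.single (Poly_Mapping.single i k) 1)" for i k
  proof (induction k)
    case 0
    then show ?case using c[of 1] by simp
  next
    case (Suc k)
    have "P (psum (2 * i + 1) * Poly_Mapping.single (Poly_Mapping.single i k) 1)"
      using Suc psum mult by simp
    then show ?case by (simp add: psum_def mult_single flip: single_add)
  qed
  have m: "P (Poly_Mapping.single m 1)" for m :: monom_p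
  proof (induction m rule: update_induct)
    case const
    then show ?case using c[of 1] by simp
  next
    case (update m a b)
    have "Poly_Mapping.update a b m = m + Poly_Mapping.single a b"
      using update by (intro poly_mapping_eqI)
        (auto simp: lookup_update lookup_add lookup_single when_def in_keys_iff)
    then have "Poly_Mapping.single (Poly_Mapping.update a b m) (1::ratfun) =
       Poly_Mapping.single m 1 * Poly_Mapping.single (Poly_Mapping.single a b) 1"
      by (simp add: mult_single)
    with update i mult show ?case by metis
  qed
  show ?thesis
  proof (induction f rule: poly_mapping_single_induct)
    case zero
    then show ?case using c[of 0] by simp
  next
    case (single m v)
    have "P (Poly_Mapping.single 0 v * Poly_Mapping.single m 1)"
      using m c mult by blast
    then show ?case by (simp add: mult_single)
  qed (use add in auto)
qed


section \<open>Exponentials of derivations\<close>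

definition fps_d_psum :: "nat \<Rightarrow> gamma fps \<Rightarrow> gamma fps"
  where "fps_d_psum n F = Abs_fps (\<lambda>k. d_psum n (fps_nth F k))"

lemma fps_d_psum_mult: "fps_d_psum n (F * G) = fps_d_psum n F * G + F * fps_d_psum n G"
  by (intro fps_ext) (simp add: fps_d_psum_def fps_mult_nth d_psum_sum d_psum_mult sum.distrib)

text \<open>Truncating the sum over \<open>n\<close> leaves a finite sum of derivations with the same low coefficients.\<close>

definition deriv_trunc :: "(nat \<Rightarrow> ratfun) \<Rightarrow> nat \<Rightarrow> gamma fps \<Rightarrow> gamma fps"
  where "deriv_trunc c N F = (\<Sum>n | odd n \<and> n \<le> N.
    fps_const (Poly_Mapping.single 0 (c n)) * (fps_X ^ n * fps_d_psum n F))"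

lemma deriv_trunc_mult: "deriv_trunc c N (F * G) = deriv_trunc c N F * G + F * deriv_trunc c N G"
  by (simp add: deriv_trunc_def fps_d_psum_mult sum_distrib_left sum_distrib_right sum.distrib distrib_left mult.assoc mult.left_commute)

lemma deriv_series_nth:
  assumes "k \<le> N"
  shows "fps_nth (deriv_series c F) k = fps_nth (deriv_trunc c N F) k"
proof -
  have "fps_nth (deriv_trunc c N F) k = (\<Sum>n | odd n \<and> n \<le> N.
      if k < n then 0 else smul (c n) (d_psum n (fps_nth F (k - n))))"
    by (simp add: deriv_trunc_def fps_sum_nth fps_mult_left_const_nth fps_X_power_mult_nth fps_d_psum_def smul_def if_distrib cong: if_cong)
  also have "\<dots> = (\<Sum>n | odd n \<and> n \<le> k. smul (c n) (d_psum n (fps_nth F (k - n))))"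
    using assms by (intro sum.mono_neutral_cong_right) auto
  finally show ?thesis by (simp add: deriv_series_def)
qed

lemma fps_nth_deriv_series:
  "fps_nth (deriv_series c F) k = (\<Sum>n | odd n \<and> n \<le> k. smul (c n) (d_psum n (fps_nth F (k - n))))"
  by (simp add: deriv_series_def)

text \<open>Used to cancel the factor \<open>Suc j\<close> when divided powers are compared.\<close>

lemma of_nat_Suc_mult_fps_eq_0:
  fixes F :: "gamma fps"
  assumes "of_nat (Suc n) * F = 0"
  shows "F = 0"
proof (rule fps_ext)
  fix k
  have "of_nat (Suc n) * fps_nth F k = fps_nth (of_nat (Suc n) * F) k"
    by (simp only: fps_of_nat[symmetric] fps_mult_left_const_nth)
  then have "of_nat (Suc n) * fps_nth F k = 0"
    by (simp only: assms fps_zero_nth)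
  then show "fps_nth F k = fps_nth 0 k"
    by (simp del: of_nat_Suc)
qed

lemma fps_mult_nth_cong:
  fixes F :: "'a::comm_semiring_1 fps"
  assumes "\<And>i. i \<le> k \<Longrightarrow> fps_nth F i = fps_nth F' i" "\<And>i. i \<le> k \<Longrightarrow> fps_nth G i = fps_nth G' i"
  shows "fps_nth (F * G) k = fps_nth (F' * G') k"
  unfolding fps_mult_nth by (rule sum.cong[OF refl]) (use assms in auto)

text \<open>The coefficient of order \<open>k\<close> sees only derivations of index at most
  \<open>k\<close>, so the operator may be replaced by the finite sum
  \<open>deriv_trunc c k\<close>.\<close>

lemma deriv_series_mult: "deriv_series c (F * G) = deriv_series c F * G + F * deriv_series c G"
proof (rule fps_ext)
  fix k
  have "fps_nth (deriv_series c F * G) k = fps_nth (deriv_trunc c k F * G) k"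
    "fps_nth (F * deriv_series c G) k = fps_nth (F * deriv_trunc c k G) k"
    by (rule fps_mult_nth_cong; simp add: deriv_series_nth)+
  then show "fps_nth (deriv_series c (F * G)) k = fps_nth (deriv_series c F * G + F * deriv_series c G) k"
    by (simp add: deriv_series_nth[of k k] deriv_trunc_mult)
qed

lemma deriv_series_add: "deriv_series c (F + G) = deriv_series c F + deriv_series c G"
  by (intro fps_ext) (simp add: deriv_series_def d_psum_add smul_add_right sum.distrib)

lemma deriv_series_zero [simp]: "deriv_series c 0 = 0"
  by (intro fps_ext) (simp add: deriv_series_def)

lemma deriv_series_sum: "deriv_series c (\<Sum>x\<in>A. F x) = (\<Sum>x\<in>A. deriv_series c (F x))"
  by (induction A rule: infinite_finite_induct) (auto simp: deriv_series_add)

text \<open>Odd indices are positive, so each application raises the order in \<open>w\<close> by at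
  least 1.\<close>

lemma deriv_series_power_nth_eq_0: "k < j \<Longrightarrow> fps_nth ((deriv_series c ^^ j) F) k = 0"
proof (induction j arbitrary: k)
  case (Suc j)
  have "d_psum n (fps_nth ((deriv_series c ^^ j) F) (k - n)) = 0" if "odd n" "n \<le> k" for n
  proof -
    have "n > 0" using that by (rule_tac odd_pos)
    then show ?thesis using that Suc by (subst Suc.IH) auto
  qed
  then show ?case by (simp add: fps_nth_deriv_series)
qed simp

text \<open>Divided powers of the derivation obey a Leibniz rule that is a plain convolution,
  without binomial coefficients.\<close>

definition divided_deriv :: "(nat \<Rightarrow> ratfun) \<Rightarrow> nat \<Rightarrow> gamma fps \<Rightarrow> gamma fps"
  where "divided_deriv c j F =
    fps_const (Poly_Mapping.single 0 (1 / of_nat (fact j))) * (deriv_series c ^^ j) F"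

lemma deriv_series_const_mult:
  "deriv_series c (fps_const (Poly_Mapping.single 0 s) * F) = fps_const (Poly_Mapping.single 0 s) * deriv_series c F"
  by (intro fps_ext)
    (simp add: deriv_series_def d_psum_smul smul_sum smul_smul mult.commute flip: smul_def)

lemma divided_deriv_Suc: "of_nat (Suc j) * divided_deriv c (Suc j) F = deriv_series c (divided_deriv c j F)"
proof -
  have "of_nat (Suc j) * (1 / of_nat (fact (Suc j))) = (1 / of_nat (fact j) :: ratfun)"
    by (simp only: fact_Suc of_nat_mult of_nat_id) (simp del: of_nat_Suc)
  then have "of_nat (Suc j) * fps_const (Poly_Mapping.single 0 (1 / of_nat (fact (Suc j)) :: ratfun)) =
      (fps_const (Poly_Mapping.single 0 (1 / of_nat (fact j))) :: gamma fps)"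
    by (metis fps_const_mult fps_of_nat mult_single of_nat_single add_0 single_of_nat)
  then show ?thesis
    by (simp add: divided_deriv_def deriv_series_const_mult flip: mult.assoc del: of_nat_Suc fact_Suc)
qed

lemma divided_deriv_0 [simp]: "divided_deriv c 0 F = F"
  by (simp add: divided_deriv_def)

lemma fps_nth_divided_deriv: "fps_nth (divided_deriv c j F) k =
    smul (1 / of_nat (fact j)) (fps_nth ((deriv_series c ^^ j) F) k)"
  by (simp add: divided_deriv_def smul_def)

lemma fps_nth_divided_deriv_eq_0: "k < j \<Longrightarrow> fps_nth (divided_deriv c j F) k = 0"
  by (simp add: fps_nth_divided_deriv deriv_series_power_nth_eq_0)

text \<open>Induction after multiplication by \<open>Suc j\<close>: differentiating the convolution
  for \<open>j\<close> gives the product with indices \<open>a\<close> and \<open>Suc j - a\<close>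
  the weight \<open>a\<close> from one factor and \<open>Suc j - a\<close> from the other, together
  \<open>Suc j\<close>.\<close>

lemma divided_deriv_mult:
  "divided_deriv c j (F * G) = (\<Sum>a\<le>j. divided_deriv c a F * divided_deriv c (j - a) G)"
proof (induction j)
  case (Suc j)
  define u where "u a = divided_deriv c a F" for a
  define v where "v a = divided_deriv c a G" for a
  have u: "deriv_series c (u a) = of_nat (Suc a) * u (Suc a)" for a
    by (simp only: u_def divided_deriv_Suc)
  have v: "deriv_series c (v a) = of_nat (Suc a) * v (Suc a)" for a
    by (simp only: v_def divided_deriv_Suc)
  have "of_nat (Suc j) * divided_deriv c (Suc j) (F * G) = (\<Sum>a\<le>j. deriv_series c (u a * v (j - a)))"
    by (simp only: divided_deriv_Suc Suc u_def[symmetric] v_def[symmetric] deriv_series_sum)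
  also have "\<dots> = (\<Sum>a\<le>j. of_nat (Suc a) * (u (Suc a) * v (j - a))) +
      (\<Sum>a\<le>j. of_nat (Suc (j - a)) * (u a * v (Suc (j - a))))"
    by (simp only: deriv_series_mult u v sum.distrib mult.assoc mult.left_commute)
  also have "(\<Sum>a\<le>j. of_nat (Suc a) * (u (Suc a) * v (j - a))) =
      (\<Sum>a\<le>Suc j. of_nat a * (u a * v (Suc j - a)))"
    by (subst sum.atMost_Suc_shift) simp
  also have "(\<Sum>a\<le>j. of_nat (Suc (j - a)) * (u a * v (Suc (j - a)))) =
      (\<Sum>a\<le>Suc j. of_nat (Suc j - a) * (u a * v (Suc j - a)))"
    by (subst sum.atMost_Suc) (simp add: Suc_diff_le)
  also have "(\<Sum>a\<le>Suc j. of_nat a * (u a * v (Suc j - a))) + \<dots> =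
      (\<Sum>a\<le>Suc j. of_nat (Suc j) * (u a * v (Suc j - a)))"
    unfolding sum.distrib[symmetric] distrib_right[symmetric] of_nat_add[symmetric]
    by (rule sum.cong) auto
  also have "\<dots> = of_nat (Suc j) * (\<Sum>a\<le>Suc j. u a * v (Suc j - a))"
    by (simp only: sum_distrib_left)
  finally have "of_nat (Suc j) * (divided_deriv c (Suc j) (F * G) - (\<Sum>a\<le>Suc j. u a * v (Suc j - a))) = 0"
    by (simp only: right_diff_distrib) simp
  then have "divided_deriv c (Suc j) (F * G) - (\<Sum>a\<le>Suc j. u a * v (Suc j - a)) = 0"
    by (rule of_nat_Suc_mult_fps_eq_0)
  then show ?case unfolding u_def v_def by (rule iffD2 [OF eq_iff_diff_eq_0])
qed simp

lemma annihilation_part_eq: "annihilation_part c k f = (\<Sum>j\<le>k. fps_nth (divided_deriv c j (fps_const f)) k)"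
  by (simp add: annihilation_part_def fps_nth_divided_deriv)

text \<open>The exponential of a derivation is a ring homomorphism. On the coefficients of
  \<open>w\<close> this is the product rule of a Hasse derivation.\<close>

lemma annihilation_part_mult:
  "annihilation_part c k (f * g) = (\<Sum>i\<le>k. annihilation_part c i f * annihilation_part c (k - i) g)"
proof -
  define u where "u a i = fps_nth (divided_deriv c a (fps_const f)) i" for a i
  define v where "v a i = fps_nth (divided_deriv c a (fps_const g)) i" for a i
  have u0: "u a i = 0" if "i < a" for a i using that by (simp add: u_def fps_nth_divided_deriv_eq_0)
  have v0: "v a i = 0" if "i < a" for a i using that by (simp add: v_def fps_nth_divided_deriv_eq_0)
  have Eu: "annihilation_part c i f = (\<Sum>a\<le>k. u a i)" if "i \<le> k" for i
    unfolding annihilation_part_eq u_def[symmetric]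
    by (rule sum.mono_neutral_left) (use that u0 in auto)
  have Ev: "annihilation_part c i g = (\<Sum>a\<le>k. v a i)" if "i \<le> k" for i
    unfolding annihilation_part_eq v_def[symmetric]
    by (rule sum.mono_neutral_left) (use that v0 in auto)
  have "annihilation_part c k (f * g) = (\<Sum>j\<le>k. \<Sum>a\<le>j. \<Sum>i\<le>k. u a i * v (j - a) (k - i))"
    by (simp add: annihilation_part_eq divided_deriv_mult fps_sum_nth fps_mult_nth u_def v_def atMost_atLeast0 flip: fps_const_mult)
  also have "\<dots> = (\<Sum>(a, b) | a + b \<le> k. \<Sum>i\<le>k. u a i * v b (k - i))"
    by (rule sum.triangle_reindex_eq [symmetric])
  \<comment> \<open>Outside the triangle \<open>i < a\<close> or \<open>k - i < b\<close> for every
    \<open>i\<close>, so the added terms vanish and \<open>a\<close> and \<open>b\<close> become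
    independent.\<close>
  also have "\<dots> = (\<Sum>(a, b) \<in> {..k} \<times> {..k}. \<Sum>i\<le>k. u a i * v b (k - i))"
  proof (rule sum.mono_neutral_left)
    show "\<forall>x\<in>{..k} \<times> {..k} - {(a, b). a + b \<le> k}. (case x of (a, b) \<Rightarrow> \<Sum>i\<le>k. u a i * v b (k - i)) = 0"
    proof
      fix x assume "x \<in> {..k} \<times> {..k} - {(a, b). a + b \<le> k}"
      then obtain a b where x: "x = (a, b)" "\<not> a + b \<le> k" by auto
      then have "i < a \<or> k - i < b" if "i \<le> k" for i
        using that by linarith
      then have "u a i * v b (k - i) = 0" if "i \<le> k" for i
        using u0[of i a] v0[of "k - i" b] that by (metis mult_zero_left mult_zero_right)
      then show "(case x of (a, b) \<Rightarrow> \<Sum>i\<le>k. u a i * v b (k - i)) = 0"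
        unfolding x(1) prod.case by (intro sum.neutral) simp
    qed
  qed auto
  also have "\<dots> = (\<Sum>a\<le>k. \<Sum>b\<le>k. \<Sum>i\<le>k. u a i * v b (k - i))"
    by (rule sum.cartesian_product [symmetric])
  also have "\<dots> = (\<Sum>a\<le>k. \<Sum>i\<le>k. \<Sum>b\<le>k. u a i * v b (k - i))"
    by (rule sum.cong[OF refl sum.swap])
  also have "\<dots> = (\<Sum>i\<le>k. \<Sum>a\<le>k. \<Sum>b\<le>k. u a i * v b (k - i))"
    by (rule sum.swap)
  also have "\<dots> = (\<Sum>i\<le>k. annihilation_part c i f * annihilation_part c (k - i) g)"
    by (rule sum.cong[OF refl]) (simp add: Eu Ev sum_product)
  finally show ?thesis .
qed

lemma deriv_series_scalar_coeffs:
  assumes "\<And>k. \<exists>s. fps_nth F k = Poly_Mapping.single 0 s"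
  shows "deriv_series c F = 0"
proof (rule fps_ext)
  fix k
  have "d_psum n (fps_nth F i) = 0" for n i
    using assms[of i] by auto
  then show "fps_nth (deriv_series c F) k = fps_nth 0 k"
    by (simp add: deriv_series_def)
qed

lemma deriv_series_power_zero [simp]: "(deriv_series c ^^ j) 0 = 0"
  by (induction j) auto

lemma annihilation_part_single [simp]:
  "annihilation_part c k (Poly_Mapping.single 0 s) = (if k = 0 then Poly_Mapping.single 0 s else 0)"
proof -
  have z: "deriv_series c (fps_const (Poly_Mapping.single 0 s)) = 0"
    by (rule deriv_series_scalar_coeffs) (metis fps_nth_fps_const single_zero)
  have j: "(deriv_series c ^^ j) (fps_const (Poly_Mapping.single 0 s)) = (if j = 0 then fps_const (Poly_Mapping.single 0 s) else 0)" for j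
    by (cases j) (auto simp: funpow_Suc_right z simp del: funpow.simps)
  show ?thesis
    unfolding annihilation_part_def j
    by (cases "k = 0") (auto intro!: sum.neutral)
qed

text \<open>The derivation sends \<open>p_n\<close> to the scalar series \<open>c_n w^n\<close> and
  that to 0. Hence the exponential substitutes \<open>p_n + c_n w^n\<close> for
  \<open>p_n\<close>.\<close>

lemma annihilation_part_psum:
  assumes n: "odd n"
  shows "annihilation_part c k (psum n) =
    (if k = 0 then psum n else if k = n then Poly_Mapping.single 0 (c n) else 0)"
proof -
  have n0: "n > 0" using n by (rule odd_pos)
  have 1: "fps_nth (deriv_series c (fps_const (psum n))) k = (if k = n then Poly_Mapping.single 0 (c n) else 0)" for k
  proof -
    have "fps_nth (deriv_series c (fps_const (psum n))) k =
      (\<Sum>m | odd m \<and> m \<le> k. if m = k then smul (c m) (d_psum m (psum n)) else 0)"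
      unfolding deriv_series_def fps_nth_Abs_fps by (rule sum.cong) auto
    also have "\<dots> = (if odd k then smul (c k) (d_psum k (psum n)) else 0)"
      by (subst sum.delta) auto
    also have "\<dots> = (if k = n then Poly_Mapping.single 0 (c n) else 0)"
      using n by (auto simp: d_psum_psum smul_def)
    finally show ?thesis .
  qed
  have z: "deriv_series c (deriv_series c (fps_const (psum n))) = 0"
    by (rule deriv_series_scalar_coeffs) (metis 1 single_zero)
  have j: "(deriv_series c ^^ j) (fps_const (psum n)) =
      (if j = 0 then fps_const (psum n) else if j = 1 then deriv_series c (fps_const (psum n)) else 0)" for j
    by (cases j; cases "j - 1") (auto simp: funpow_Suc_right z simp del: funpow.simps)
  show ?thesis
  proof (cases "k = 0")
    case True then show ?thesis by (simp add: annihilation_part_def)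
  next
    case False
    have "annihilation_part c k (psum n) = (\<Sum>i\<in>{1}. smul (1 / of_nat (fact i)) (fps_nth ((deriv_series c ^^ i) (fps_const (psum n))) k))"
      unfolding annihilation_part_def
      by (rule sum.mono_neutral_right) (use False in \<open>auto simp: j\<close>)
    then show ?thesis using False by (simp add: 1)
  qed
qed

lemma deriv_series_power_add: "(deriv_series c ^^ j) (F + G) = (deriv_series c ^^ j) F + (deriv_series c ^^ j) G"
  by (induction j) (auto simp: deriv_series_add)

lemma annihilation_part_add: "annihilation_part c k (f + g) = annihilation_part c k f + annihilation_part c k g"
  by (simp add: annihilation_part_def deriv_series_power_add smul_add_right sum.distrib flip: fps_const_add)

lemma annihilation_part_smul: "annihilation_part c k (smul s f) = smul s (annihilation_part c k f)"
  unfolding smul_def annihilation_part_mult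
  by (subst sum.atMost_shift) simp

lemma annihilation_part_zero [simp]: "annihilation_part c k 0 = 0"
  using annihilation_part_single[of c k 0] by simp

lemma annihilation_part_one: "annihilation_part c k 1 = (if k = 0 then 1 else 0)"
  using annihilation_part_single[of c k 1] by (auto split: if_splits)

lemma annihilation_part_0 [simp]: "annihilation_part c 0 f = f"
  by (simp add: annihilation_part_def)

lemma annihilation_part_sum: "annihilation_part c k (\<Sum>x\<in>A. f x) = (\<Sum>x\<in>A. annihilation_part c k (f x))"
  by (induction A rule: infinite_finite_induct) (auto simp: annihilation_part_add)

text \<open>The substitution turns a polynomial into a polynomial in \<open>w\<close>. This makes
  the sum in \<open>vertex_op\<close> finite, with a bound depending on \<open>f\<close>.\<close>

lemma annihilation_part_eventually_0: "\<exists>N. \<forall>k>N. annihilation_part c k f = 0"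
proof (induction f rule: gamma_induct)
  case (const s) then show ?case by (intro exI[of _ 0]) auto
next
  case (psum n) then show ?case by (intro exI[of _ n]) (auto simp: annihilation_part_psum)
next
  case (add f g)
  then obtain M N where "\<forall>k>M. annihilation_part c k f = 0" "\<forall>k>N. annihilation_part c k g = 0" by auto
  then show ?case by (intro exI[of _ "max M N"]) (auto simp: annihilation_part_add)
next
  case (mult f g)
  then obtain M N where MN: "\<forall>k>M. annihilation_part c k f = 0" "\<forall>k>N. annihilation_part c k g = 0" by auto
  have "annihilation_part c k (f * g) = 0" if "k > M + N" for k
    unfolding annihilation_part_mult
  proof (intro sum.neutral ballI)
    fix i assume "i \<in> {..k}"
    then have "i > M \<or> k - i > N" using that by auto
    then show "annihilation_part c i f * annihilation_part c (k - i) g = 0" using MN by auto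
  qed
  then show ?case by blast
qed


section \<open>The creation series\<close>

text \<open>On a product both orders give the same double sum over splittings, so the generators
  decide.\<close>

lemma annihilation_part_commute:
  "annihilation_part c i (annihilation_part d j f) = annihilation_part d j (annihilation_part c i f)"
proof (induction f arbitrary: i j rule: gamma_induct)
  case (mult f g)
  then show ?case
    by (simp add: annihilation_part_mult annihilation_part_sum sum.swap[of _ "{..i}" "{..j}"])
qed (auto simp: annihilation_part_add annihilation_part_psum annihilation_part_one)

text \<open>This is \<open>exp (C + D) = exp C exp D\<close> for two commuting derivations, checked
  on generators and products.\<close>

lemma annihilation_part_compose:
  "annihilation_part (\<lambda>n. c n + d n) k f = (\<Sum>i\<le>k. annihilation_part c i (annihilation_part d (k - i) f))"
proof (induction f arbitrary: k rule: gamma_induct)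
  case (const s)
  have "annihilation_part c i (annihilation_part d (k - i) (Poly_Mapping.single 0 s)) =
    (if i = 0 then if k = 0 then Poly_Mapping.single 0 s else 0 else 0)" if "i \<le> k" for i
    using that by auto
  then show ?case by (simp add: sum.delta)
next
  case (psum n)
  have n0: "n > 0" using psum by (rule odd_pos)
  have *: "annihilation_part c i (annihilation_part d (k - i) (Defs.psum n)) =
    (if i = 0 then annihilation_part d k (Defs.psum n) else 0) +
    (if i = k then if k = n then Poly_Mapping.single 0 (c n) else 0 else 0)" if "i \<le> k" for i
    using that n0 by (auto simp: annihilation_part_psum[OF psum])
  have "(\<Sum>i\<le>k. annihilation_part c i (annihilation_part d (k - i) (Defs.psum n))) =
    (\<Sum>i\<le>k. (if i = 0 then annihilation_part d k (Defs.psum n) else 0) +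
    (if i = k then if k = n then Poly_Mapping.single 0 (c n) else 0 else 0))"
    by (rule sum.cong[OF refl]) (simp add: *)
  also have "\<dots> = annihilation_part d k (Defs.psum n) + (if k = n then Poly_Mapping.single 0 (c n) else 0)"
    by (simp add: sum.distrib sum.delta)
  also have "\<dots> = annihilation_part (\<lambda>n. c n + d n) k (Defs.psum n)"
    using n0 by (auto simp: annihilation_part_psum[OF psum] single_add)
  finally show ?case ..
next
  case (add f g)
  then show ?case by (simp add: annihilation_part_add sum.distrib)
next
  case (mult f g)
  define h where "h a b l m = annihilation_part c a (annihilation_part d l f) *
    annihilation_part c b (annihilation_part d m g)" for a b l m
  have "annihilation_part (\<lambda>n. c n + d n) k (f * g) =
    (\<Sum>p\<le>k. \<Sum>i\<le>p. \<Sum>j\<le>k - p. h i j (p - i) (k - p - j))"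
    by (simp add: annihilation_part_mult mult sum_product h_def)
  also have "\<dots> = (\<Sum>(p, i, j) \<in> (SIGMA p:{..k}. SIGMA i:{..p}. {..k - p}). h i j (p - i) (k - p - j))"
    by (simp add: sum.Sigma)
  \<comment> \<open>Both sides sum \<open>h\<close> over quadruples of total \<open>k\<close>. They
    are grouped first by the degree falling on \<open>f\<close>, then by the degree belonging to
    \<open>c\<close>.\<close>
  also have "\<dots> = (\<Sum>(i, l, a) \<in> (SIGMA i:{..k}. SIGMA l:{..k - i}. {..i}). h a (i - a) l (k - i - l))"
    by (rule sum.reindex_bij_witness[of _ "\<lambda>(i, l, a). (a + l, a, i - a)" "\<lambda>(p, i, j). (i + j, p - i, i)"])
      (auto simp: diff_diff_eq add.commute add.left_commute)
  also have "\<dots> = (\<Sum>i\<le>k. \<Sum>l\<le>k - i. \<Sum>a\<le>i. h a (i - a) l (k - i - l))"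
    by (simp add: sum.Sigma)
  also have "\<dots> = (\<Sum>i\<le>k. annihilation_part c i (annihilation_part d (k - i) (f * g)))"
    by (simp add: annihilation_part_mult annihilation_part_sum h_def)
  finally show ?case .
qed

text \<open>Scaling \<open>c n\<close> by \<open>s ^ n\<close> amounts to replacing \<open>w\<close>
  by \<open>s w\<close>.\<close>

lemma annihilation_part_scale:
  "annihilation_part (\<lambda>n. s ^ n * c n) k f = smul (s ^ k) (annihilation_part c k f)"
proof (induction f arbitrary: k rule: gamma_induct)
  case (mult f g)
  have "smul (s ^ i) x * smul (s ^ (k - i)) y = smul (s ^ k) (x * y)" if "i \<le> k" for i x y
    using that by (simp add: smul_mult_left smul_mult_right smul_smul flip: power_add)
  then show ?case
    by (simp add: annihilation_part_mult mult smul_sum)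
qed (auto simp: annihilation_part_add annihilation_part_psum smul_def mult_single distrib_left)

definition odd_psum_series :: "gamma fps"
  where "odd_psum_series = Abs_fps (\<lambda>n. if odd n then smul (2 / of_nat n) (psum n) else 0)"

lemma fps_power_nth_eq_0:
  fixes F :: "'a::comm_ring_1 fps"
  assumes "fps_nth F 0 = 0" "k < j"
  shows "fps_nth (F ^ j) k = 0"
  using assms(2)
proof (induction j arbitrary: k)
  case (Suc j)
  have "fps_nth F i * fps_nth (F ^ j) (k - i) = 0" if "i \<le> k" for i
    using that Suc assms by (cases "i = 0") auto
  then show ?case by (simp add: fps_mult_nth)
qed simp

lemma fps_deriv_odd_psum_series:
  "fps_nth (fps_deriv odd_psum_series) i = (if even i then 2 * psum (Suc i) else 0)"
proof -
  have "of_nat (Suc i) * smul (2 / of_nat (Suc i)) x = 2 * x" for x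
    using smul_of_nat[of 2 x]
    by (simp add: smul_smul flip: smul_of_nat del: of_nat_Suc)
  then show ?thesis by (auto simp: odd_psum_series_def simp del: of_nat_Suc)
qed

lemma odd_psum_series_0: "fps_nth odd_psum_series 0 = 0"
  by (simp add: odd_psum_series_def)

lemma creation_part_nth:
  assumes "k \<le> N"
  shows "fps_nth creation_part k = (\<Sum>j\<le>N. smul (1 / of_nat (fact j)) (fps_nth (odd_psum_series ^ j) k))"
proof -
  have "fps_nth creation_part k = (\<Sum>j\<le>k. smul (1 / of_nat (fact j)) (fps_nth (odd_psum_series ^ j) k))"
    by (simp add: creation_part_def gamma_fps_exp_def odd_psum_series_def)
  also have "\<dots> = (\<Sum>j\<le>N. smul (1 / of_nat (fact j)) (fps_nth (odd_psum_series ^ j) k))"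
    by (rule sum.mono_neutral_left) (use assms in \<open>auto simp: fps_power_nth_eq_0 odd_psum_series_0\<close>)
  finally show ?thesis .
qed

lemma creation_part_0 [simp]: "fps_nth creation_part 0 = 1"
  by (simp add: creation_part_nth[of 0 0])

lemma smul_inverse_fact_Suc:
  "smul (1 / of_nat (fact (Suc j))) (of_nat (Suc j) * x) = smul (1 / of_nat (fact j)) x"
  by (simp only: smul_of_nat[symmetric] smul_smul fact_Suc of_nat_mult of_nat_id) (simp del: of_nat_Suc)

text \<open>Termwise differentiation of the exponential. As \<open>F ^ j\<close> starts in order
  \<open>j\<close>, all coefficients up to \<open>k\<close> can be summed over the same range
  \<open>j <= k\<close>, and the sum factors into a product of series.\<close>

lemma fps_deriv_creation_part: "fps_deriv creation_part = fps_deriv odd_psum_series * creation_part"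
proof (rule fps_ext)
  fix k
  define F where "F = odd_psum_series"
  have "fps_nth (fps_deriv creation_part) k =
    (\<Sum>j\<le>Suc k. smul (1 / of_nat (fact j)) (of_nat (Suc k) * fps_nth (F ^ j) (Suc k)))"
    by (simp only: fps_deriv_nth creation_part_nth[OF order_refl] F_def sum_distrib_left smul_mult_right Suc_eq_plus1[symmetric])
  also have "\<dots> = (\<Sum>j\<le>Suc k. smul (1 / of_nat (fact j)) (fps_nth (fps_deriv (F ^ j)) k))"
    by (simp only: fps_deriv_nth Suc_eq_plus1)
  also have "\<dots> = (\<Sum>j\<le>k. smul (1 / of_nat (fact (Suc j))) (fps_nth (fps_deriv (F ^ Suc j)) k))"
    by (subst sum.atMost_Suc_shift) simp
  also have "\<dots> = (\<Sum>j\<le>k. smul (1 / of_nat (fact (Suc j))) (of_nat (Suc j) * fps_nth (fps_deriv F * F ^ j) k))"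
  proof -
    have "fps_nth (fps_deriv (F ^ Suc j)) k = of_nat (Suc j) * fps_nth (fps_deriv F * F ^ j) k" for j
    proof -
      have "fps_deriv (F ^ Suc j) = fps_const (of_nat (Suc j)) * (fps_deriv F * F ^ j)"
        by (simp only: fps_deriv_power diff_Suc_1 mult.assoc)
      then show ?thesis by (simp only: fps_mult_left_const_nth)
    qed
    then show ?thesis by (simp only:)
  qed
  also have "\<dots> = (\<Sum>j\<le>k. smul (1 / of_nat (fact j)) (fps_nth (fps_deriv F * F ^ j) k))"
    by (simp only: smul_inverse_fact_Suc)
  also have "\<dots> = (\<Sum>j\<le>k. \<Sum>i\<le>k. fps_nth (fps_deriv F) i * smul (1 / of_nat (fact j)) (fps_nth (F ^ j) (k - i)))"
    by (simp only: fps_mult_nth smul_sum smul_mult_right atMost_atLeast0)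
  also have "\<dots> = (\<Sum>i\<le>k. fps_nth (fps_deriv F) i * (\<Sum>j\<le>k. smul (1 / of_nat (fact j)) (fps_nth (F ^ j) (k - i))))"
    by (subst sum.swap) (simp only: sum_distrib_left)
  also have "\<dots> = (\<Sum>i\<le>k. fps_nth (fps_deriv F) i * fps_nth creation_part (k - i))"
    by (simp only: F_def creation_part_nth[OF diff_le_self])
  also have "\<dots> = fps_nth (fps_deriv F * creation_part) k"
    by (simp only: fps_mult_nth atMost_atLeast0)
  finally show "fps_nth (fps_deriv creation_part) k = fps_nth (fps_deriv odd_psum_series * creation_part) k"
    unfolding F_def .
qed

text \<open>Coefficients of the differential equation. For positive \<open>m\<close> it expresses a
  creation coefficient by earlier ones and so supports strong induction.\<close>

lemma creation_part_recursion:
  "of_nat m * fps_nth creation_part m =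
    (\<Sum>n | odd n \<and> n \<le> m. 2 * (psum n * fps_nth creation_part (m - n)))"
proof (cases m)
  case 0
  have "(\<Sum>n | odd n \<and> n \<le> 0. g n) = 0" for g :: "nat \<Rightarrow> gamma"
    by (rule sum.neutral) (auto dest: odd_pos)
  then show ?thesis unfolding 0 by (simp only: of_nat_0 mult_zero_left)
next
  case (Suc k)
  have "of_nat m * fps_nth creation_part m = fps_nth (fps_deriv odd_psum_series * creation_part) k"
    unfolding Suc fps_deriv_creation_part[symmetric] by simp
  also have "\<dots> = (\<Sum>i\<le>k. if even i then 2 * (psum (Suc i) * fps_nth creation_part (k - i)) else 0)"
    unfolding fps_mult_nth fps_deriv_odd_psum_series atMost_atLeast0 by (rule sum.cong[OF refl]) simp
  also have "\<dots> = (\<Sum>i | i \<le> k \<and> even i. 2 * (psum (Suc i) * fps_nth creation_part (k - i)))"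
    by (simp add: sum.If_cases Int_def)
  also have "\<dots> = (\<Sum>n | odd n \<and> n \<le> m. 2 * (psum n * fps_nth creation_part (m - n)))"
    by (rule sum.reindex_bij_witness[of _ "\<lambda>n. n - 1" Suc]) (auto simp: Suc elim: oddE)
  finally show ?thesis .
qed

text \<open>The creation series \<open>C\<close> is the exponential of an odd series, so
  \<open>C(-z) C(z) = 1\<close>. Concretely, \<open>P\<close> is even, hence
  \<open>M(z) = C(-z)\<close> satisfies \<open>M' = - P M\<close>, and \<open>M C\<close> has
  derivative 0.\<close>

lemma creation_part_alternating_convolution:
  assumes "k > 0"
  shows "(\<Sum>i\<le>k. (-1) ^ i * (fps_nth creation_part i * fps_nth creation_part (k - i))) = 0"
proof -
  define C where "C = creation_part"
  define M where "M = Abs_fps (\<lambda>n. (-1) ^ n * fps_nth C n)"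
  define P where "P = fps_deriv odd_psum_series"
  have C': "fps_deriv C = P * C"
    by (simp add: C_def P_def fps_deriv_creation_part)
  have M': "fps_deriv M = - (P * M)"
  proof (rule fps_ext)
    fix n
    have "fps_nth (fps_deriv M) n = (-1) ^ Suc n * fps_nth (fps_deriv C) n"
      by (simp add: M_def algebra_simps)
    also have "\<dots> = (\<Sum>i\<le>n. (-1) ^ Suc n * (fps_nth P i * fps_nth C (n - i)))"
      by (simp only: C' fps_mult_nth sum_distrib_left atMost_atLeast0)
    also have "\<dots> = (\<Sum>i\<le>n. - (fps_nth P i * fps_nth M (n - i)))"
    proof (rule sum.cong[OF refl])
      fix i assume "i \<in> {..n}"
      then have "(-1 :: gamma) ^ (n - i) = (-1) ^ n" if "even i"
        using that by (simp add: minus_one_power_iff)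
      then show "(-1) ^ Suc n * (fps_nth P i * fps_nth C (n - i)) = - (fps_nth P i * fps_nth M (n - i))"
        by (cases "even i") (simp_all add: P_def fps_deriv_odd_psum_series M_def mult.left_commute del: fps_deriv_nth)
    qed
    also have "\<dots> = fps_nth (- (P * M)) n"
      by (simp add: fps_mult_nth sum_negf atMost_atLeast0)
    finally show "fps_nth (fps_deriv M) n = fps_nth (- (P * M)) n" .
  qed
  have "fps_deriv (M * C) = 0"
    by (simp add: C' M' mult.left_commute)
  then have "M * C = fps_const (fps_nth (M * C) 0)"
    by (simp only: fps_deriv_eq_0_iff)
  then have "fps_nth (M * C) k = 0"
    using assms by (metis fps_nth_fps_const gr_implies_not0)
  then show ?thesis
    by (simp add: fps_mult_nth M_def C_def atMost_atLeast0 mult.assoc)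
qed

text \<open>The coefficients of \<open>(1 + s u) / (1 - s u)\<close>, the factor that arises when an
  annihilation series passes a creation series.\<close>

definition qcoef :: "ratfun \<Rightarrow> nat \<Rightarrow> ratfun"
  where "qcoef s i = (if i = 0 then 1 else 2 * s ^ i)"

lemma card_odd_less: "card {n. odd n \<and> n < i} = i div 2"
proof (induction i)
  case (Suc i)
  have "{n. odd n \<and> n < Suc i} = (if odd i then insert i {n. odd n \<and> n < i} else {n. odd n \<and> n < i})"
    by (auto simp: less_Suc_eq)
  then show ?case using Suc by (auto elim: oddE)
qed simp

text \<open>The analogue of \<open>creation_part_recursion\<close> with \<open>s ^ n\<close> for
  \<open>psum n\<close>. Each odd \<open>n < i\<close> contributes \<open>4 * s ^ i\<close>, there
  are \<open>i div 2\<close> of them, and \<open>n = i\<close> contributes \<open>2 * s ^ i\<close>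
  when \<open>i\<close> is odd.\<close>

lemma qcoef_recursion: "(\<Sum>n | odd n \<and> n \<le> i. 2 * s ^ n * qcoef s (i - n)) = of_nat i * qcoef s i"
proof -
  have set: "{n. odd n \<and> n \<le> i} = {n. odd n \<and> n < i} \<union> (if odd i then {i} else {})"
    by (auto simp: le_less)
  have lt: "2 * s ^ n * qcoef s (i - n) = 4 * s ^ i" if "n < i" for n
    using that by (simp add: qcoef_def flip: power_add)
  have "(\<Sum>n | odd n \<and> n \<le> i. 2 * s ^ n * qcoef s (i - n)) =
    (\<Sum>n | odd n \<and> n < i. 2 * s ^ n * qcoef s (i - n)) + (if odd i then 2 * s ^ i else 0)"
    unfolding set by (subst sum.union_disjoint) (auto simp: qcoef_def)
  also have "(\<Sum>n | odd n \<and> n < i. 2 * s ^ n * qcoef s (i - n)) = of_nat (i div 2) * (4 * s ^ i)"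
    by (simp add: lt card_odd_less)
  also have "of_nat (i div 2) * (4 * s ^ i) + (if odd i then 2 * s ^ i else 0) = of_nat i * qcoef s i"
    by (cases "even i") (auto elim!: evenE oddE simp: qcoef_def algebra_simps)
  finally show ?thesis .
qed

text \<open>Substituting \<open>p_n + s^n w^n\<close> multiplies the creation series by
  \<open>(1 + s w z) / (1 - s w z)\<close>. The proof compares \<open>m\<close> times both sides, by
  strong induction along the recursion.\<close>

lemma annihilation_part_creation_part:
  assumes c: "\<And>n. odd n \<Longrightarrow> c n = s ^ n"
  shows "annihilation_part c i (fps_nth creation_part m) =
    (if i \<le> m then smul (qcoef s i) (fps_nth creation_part (m - i)) else 0)"
proof (induction m arbitrary: i rule: less_induct)
  case (less m)
  define C where "C = fps_nth creation_part"
  show ?case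
  proof (cases "m = 0")
    case True
    then show ?thesis by (auto simp: annihilation_part_one qcoef_def)
  next
    case m: False
    have IH: "annihilation_part c i (C k) = (if i \<le> k then smul (qcoef s i) (C (k - i)) else 0)" if "k < m" for i k
      using less that by (simp add: C_def)
    have E_term: "annihilation_part c i (2 * (psum n * C (m - n))) =
      2 * (psum n * annihilation_part c i (C (m - n))) + (if n \<le> i then smul (2 * s ^ n) (annihilation_part c (i - n) (C (m - n))) else 0)"
      if n: "odd n" for n
    proof -
      have n0: "n > 0" using n by (rule odd_pos)
      have two: "2 * x = smul 2 x" for x using smul_of_nat[of 2 x] by simp
      have "annihilation_part c i (psum n * C (m - n)) =
        (\<Sum>a\<le>i. (if a = 0 then psum n * annihilation_part c i (C (m - n)) else 0) +
          (if a = n then smul (s ^ n) (annihilation_part c (i - n) (C (m - n))) else 0))"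
        unfolding annihilation_part_mult
        by (rule sum.cong[OF refl]) (use n0 in \<open>auto simp: annihilation_part_psum[OF n] c[OF n] smul_def\<close>)
      also have "\<dots> = psum n * annihilation_part c i (C (m - n)) +
          (if n \<le> i then smul (s ^ n) (annihilation_part c (i - n) (C (m - n))) else 0)"
        by (simp add: sum.distrib sum.delta)
      finally show ?thesis
        unfolding two annihilation_part_smul by (simp add: smul_add_right smul_smul)
    qed
    have "of_nat m * annihilation_part c i (C m) = annihilation_part c i (of_nat m * C m)"
      by (simp only: smul_of_nat[symmetric] annihilation_part_smul)
    also have "\<dots> = (\<Sum>n | odd n \<and> n \<le> m. annihilation_part c i (2 * (psum n * C (m - n))))"
      unfolding C_def creation_part_recursion annihilation_part_sum ..
    also have "\<dots> = (\<Sum>n | odd n \<and> n \<le> m. 2 * (psum n * annihilation_part c i (C (m - n)))) +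
      (\<Sum>n | odd n \<and> n \<le> m. if n \<le> i then smul (2 * s ^ n) (annihilation_part c (i - n) (C (m - n))) else 0)"
      by (simp add: E_term sum.distrib)
    \<comment> \<open>Contributions that leave \<open>psum n\<close> unchanged: the recursion at
      \<open>m - i\<close> gives them the factor \<open>m - i\<close>.\<close>
    also have "(\<Sum>n | odd n \<and> n \<le> m. 2 * (psum n * annihilation_part c i (C (m - n)))) =
      (if i \<le> m then smul (qcoef s i) (of_nat (m - i) * C (m - i)) else 0)"
    proof (cases "i \<le> m")
      case True
      have "(\<Sum>n | odd n \<and> n \<le> m. 2 * (psum n * annihilation_part c i (C (m - n)))) =
         (\<Sum>n | odd n \<and> n \<le> m. if n \<le> m - i then smul (qcoef s i) (2 * (psum n * C (m - i - n))) else 0)"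
      proof (rule sum.cong[OF refl])
        fix n assume "n \<in> {n. odd n \<and> n \<le> m}"
        then have n: "n \<le> m" and "m - n < m" using odd_pos[of n] m by auto
        note IH = IH[OF this(2)]
        have "m - n - i = m - i - n" by simp
        then show "2 * (psum n * annihilation_part c i (C (m - n))) =
          (if n \<le> m - i then smul (qcoef s i) (2 * (psum n * C (m - i - n))) else 0)"
          using n True by (subst IH) (auto simp: smul_mult_right)
      qed
      also have "\<dots> = (\<Sum>n | odd n \<and> n \<le> m - i. smul (qcoef s i) (2 * (psum n * C (m - i - n))))"
        by (rule sum.mono_neutral_cong_right) auto
      also have "\<dots> = smul (qcoef s i) (of_nat (m - i) * C (m - i))"
        unfolding C_def creation_part_recursion smul_sum ..
      finally show ?thesis using True by simp
    next
      case False
      have "annihilation_part c i (C (m - n)) = 0" if "odd n" "n \<le> m" for n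
      proof -
        have "m - n < m" using that odd_pos[of n] m by auto
        then show ?thesis by (subst IH) (use False in auto)
      qed
      then show ?thesis using False by simp
    qed
    \<comment> \<open>Contributions that replace \<open>psum n\<close> by \<open>s ^ n\<close>: the
      recursion for \<open>qcoef\<close> gives them the factor \<open>i\<close>, and the two factors
      add up to \<open>m\<close>.\<close>
    also have "(\<Sum>n | odd n \<and> n \<le> m. if n \<le> i then smul (2 * s ^ n) (annihilation_part c (i - n) (C (m - n))) else 0) =
       (if i \<le> m then smul (of_nat i * qcoef s i) (C (m - i)) else 0)"
    proof -
      have e: "(if n \<le> i then smul (2 * s ^ n) (annihilation_part c (i - n) (C (m - n))) else 0) =
         (if n \<le> i \<and> i \<le> m then smul (2 * s ^ n * qcoef s (i - n)) (C (m - i)) else 0)" if n: "odd n" "n \<le> m" for n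
      proof -
        have "m - n < m" using n odd_pos[of n] m by auto
        note IH = IH[OF this]
        show ?thesis using n by (subst IH) (auto simp: smul_smul)
      qed
      have "(\<Sum>n | odd n \<and> n \<le> m. if n \<le> i then smul (2 * s ^ n) (annihilation_part c (i - n) (C (m - n))) else 0) =
         (\<Sum>n | odd n \<and> n \<le> m. if n \<le> i \<and> i \<le> m then smul (2 * s ^ n * qcoef s (i - n)) (C (m - i)) else 0)"
        by (rule sum.cong[OF refl]) (simp add: e)
      also have "\<dots> = (if i \<le> m then (\<Sum>n | odd n \<and> n \<le> i. smul (2 * s ^ n * qcoef s (i - n)) (C (m - i))) else 0)"
      proof (cases "i \<le> m")
        case True
        then show ?thesis by (simp, intro sum.mono_neutral_cong_right) auto
      qed simp
      also have "\<dots> = (if i \<le> m then smul (\<Sum>n | odd n \<and> n \<le> i. 2 * s ^ n * qcoef s (i - n)) (C (m - i)) else 0)"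
      proof -
        have "smul (sum g A) x = (\<Sum>n\<in>A. smul (g n) x)" for g :: "nat \<Rightarrow> ratfun" and A x
          by (induction A rule: infinite_finite_induct) (auto simp: smul_add_left)
        then show ?thesis by simp
      qed
      finally show ?thesis by (simp only: qcoef_recursion)
    qed
    also have "(if i \<le> m then smul (qcoef s i) (of_nat (m - i) * C (m - i)) else 0) +
        (if i \<le> m then smul (of_nat i * qcoef s i) (C (m - i)) else 0) =
      of_nat m * (if i \<le> m then smul (qcoef s i) (C (m - i)) else 0)"
    proof (cases "i \<le> m")
      case True
      have "smul (qcoef s i) (of_nat (m - i) * C (m - i)) + smul (of_nat i * qcoef s i) (C (m - i)) =
        smul (of_nat (m - i) * qcoef s i + of_nat i * qcoef s i) (C (m - i))"
        unfolding smul_of_nat[symmetric] smul_smul smul_add_left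
        by (simp only: mult.commute[of "qcoef s i" "of_nat (m - i)"])
      also have "of_nat (m - i) * qcoef s i + of_nat i * qcoef s i = of_nat m * qcoef s i"
        using True by (simp flip: distrib_right of_nat_add)
      also have "smul (of_nat m * qcoef s i) (C (m - i)) = of_nat m * smul (qcoef s i) (C (m - i))"
        by (simp only: smul_of_nat[symmetric] smul_smul)
      finally show ?thesis using True by simp
    qed auto
    finally show ?thesis using m by (simp add: C_def)
  qed
qed


section \<open>Relations between the vertex operators\<close>

text \<open>The value 0 at negative indices lets indices be shifted without side conditions.\<close>

definition creation_coeff :: "int \<Rightarrow> gamma"
  where "creation_coeff m = (if m \<ge> 0 then fps_nth creation_part (nat m) else 0)"

lemma vertex_op_eq:
  assumes "\<forall>k>N. annihilation_part c k f = 0"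
  shows "vertex_op c n f = (\<Sum>k\<le>N. creation_coeff (n + int k) * annihilation_part c k f)"
  unfolding vertex_op_def creation_coeff_def
proof (subst Sum_any.expand_superset[of "{..N}"])
  show "{a. (if 0 \<le> n + int a then fps_nth creation_part (nat (n + int a)) * annihilation_part c a f else 0) \<noteq> 0} \<subseteq> {..N}"
  proof
    fix a assume "a \<in> {a. (if 0 \<le> n + int a then fps_nth creation_part (nat (n + int a)) * annihilation_part c a f else 0) \<noteq> 0}"
    then have "annihilation_part c a f \<noteq> 0" by (auto split: if_splits)
    then show "a \<in> {..N}" using assms by (meson atMost_iff not_le)
  qed
qed (auto intro!: sum.cong)

lemma vertex_op_add: "vertex_op c n (f + g) = vertex_op c n f + vertex_op c n g"
proof -
  obtain M where M: "\<forall>k>M. annihilation_part c k f = 0"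
    using annihilation_part_eventually_0 by blast
  obtain N where N: "\<forall>k>N. annihilation_part c k g = 0"
    using annihilation_part_eventually_0 by blast
  define K where "K = max M N"
  have "\<forall>k>K. annihilation_part c k f = 0" "\<forall>k>K. annihilation_part c k g = 0"
    "\<forall>k>K. annihilation_part c k (f + g) = 0"
    using M N by (auto simp: K_def annihilation_part_add)
  then show ?thesis
    by (simp add: vertex_op_eq[of K] annihilation_part_add distrib_left sum.distrib)
qed

lemma vertex_op_smul: "vertex_op c n (smul s f) = smul s (vertex_op c n f)"
proof -
  obtain N where N: "\<forall>k>N. annihilation_part c k f = 0"
    using annihilation_part_eventually_0 by blast
  then have "\<forall>k>N. annihilation_part c k (smul s f) = 0"
    by (simp add: annihilation_part_smul)
  with N show ?thesis
    by (simp add: vertex_op_eq[of N] annihilation_part_smul smul_mult_right smul_sum)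
qed

lemma vertex_op_zero [simp]: "vertex_op c n 0 = 0"
  using vertex_op_smul[of c n 0 0] by simp

lemma vertex_op_one: "vertex_op c n 1 = creation_coeff n"
  by (subst vertex_op_eq[of 0]) (auto simp: annihilation_part_one)

lemma annihilation_part_creation_coeff:
  assumes "\<And>n. odd n \<Longrightarrow> c n = s ^ n"
  shows "annihilation_part c i (creation_coeff m) = smul (qcoef s i) (creation_coeff (m - int i))"
proof (cases "m \<ge> 0")
  case True
  then obtain k where "m = int k" using nonneg_int_cases by blast
  then show ?thesis
    by (auto simp: creation_coeff_def annihilation_part_creation_part[OF assms] nat_diff_distrib)
qed (simp add: creation_coeff_def)

text \<open>For the series \<open>V(z)\<close> of vertex operators this reads
  \<open>A(w) V(z) = (1 + s w z) / (1 - s w z) V(z) A(w)\<close>. By the product rule one factor of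
  each summand is a shifted creation coefficient; the other commutes with the annihilation parts
  inside \<open>V\<close>.\<close>

lemma annihilation_part_vertex_op:
  assumes "\<And>n. odd n \<Longrightarrow> c n = s ^ n"
  shows "annihilation_part c k (vertex_op d n f) =
    (\<Sum>i\<le>k. smul (qcoef s i) (vertex_op d (n - int i) (annihilation_part c (k - i) f)))"
proof -
  obtain N where N: "\<forall>k>N. annihilation_part d k f = 0"
    using annihilation_part_eventually_0 by blast
  then have N': "\<forall>k>N. annihilation_part d k (annihilation_part c j f) = 0" for j
    by (simp add: annihilation_part_commute[of d _ c])
  have "annihilation_part c k (vertex_op d n f) =
    (\<Sum>r\<le>N. \<Sum>i\<le>k. smul (qcoef s i) (creation_coeff (n - int i + int r) * annihilation_part d r (annihilation_part c (k - i) f)))"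
    unfolding vertex_op_eq[OF N] annihilation_part_sum annihilation_part_mult
  proof (intro sum.cong[OF refl])
    fix r i
    show "annihilation_part c i (creation_coeff (n + int r)) * annihilation_part c (k - i) (annihilation_part d r f) =
      smul (qcoef s i) (creation_coeff (n - int i + int r) * annihilation_part d r (annihilation_part c (k - i) f))"
      using annihilation_part_creation_coeff[OF assms, where i = i and m = "n + int r"]
      by (simp add: annihilation_part_commute[of d _ c] smul_mult_left diff_add_eq)
  qed
  also have "\<dots> = (\<Sum>i\<le>k. smul (qcoef s i) (vertex_op d (n - int i) (annihilation_part c (k - i) f)))"
    unfolding vertex_op_eq[OF N'] smul_sum by (rule sum.swap)
  finally show ?thesis .
qed

text \<open>The family \<open>A\<^sub>k\<close> of the overview, the case \<open>s = 1\<close> of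
  the relations above.\<close>

abbreviation annih :: "nat \<Rightarrow> gamma \<Rightarrow> gamma"
  where "annih \<equiv> annihilation_part (\<lambda>_. 1)"

text \<open>Multiply \<open>A(w) Q(z) = (1 + w z) / (1 - w z) Q(z) A(w)\<close> by
  \<open>1 - w z\<close> and compare coefficients.\<close>

lemma annih_Q_op_Suc:
  "annih (Suc k) (Q_op n f) = annih k (Q_op (n - 1) f) + Q_op n (annih (Suc k) f) + Q_op (n - 1) (annih k f)"
proof -
  define x where "x i = Q_op (n - 1 - int i) (annih (k - i) f)" for i
  have x: "Q_op (n - (1 + int i)) (annih (k - i) f) = x i" for i
    by (simp add: x_def algebra_simps)
  have 1: "annih (Suc k) (Q_op n f) = Q_op n (annih (Suc k) f) + (\<Sum>i\<le>k. smul 2 (x i))"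
    unfolding Q_op_def
    by (subst annihilation_part_vertex_op[of _ 1], simp, subst sum.atMost_Suc_shift)
      (simp add: qcoef_def x flip: Q_op_def)
  have 2: "annih k (Q_op (n - 1) f) = (\<Sum>i\<le>k. smul (qcoef 1 i) (x i))"
    unfolding Q_op_def x_def by (subst annihilation_part_vertex_op[of _ 1]) simp_all
  \<comment> \<open>\<open>qcoef 1\<close> differs from the constant 2 only at index 0; the surplus
    \<open>x 0\<close> is the last term of the relation.\<close>
  have "(\<Sum>i\<le>k. smul 2 (x i)) = (\<Sum>i\<le>k. smul (qcoef 1 i) (x i) + (if i = 0 then x i else 0))"
    by (rule sum.cong[OF refl]) (simp add: qcoef_def flip: smul_add_left[of 1 1, simplified])
  also have "\<dots> = annih k (Q_op (n - 1) f) + x 0"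
    by (simp add: 2 sum.distrib sum.delta)
  finally show ?thesis unfolding 1 by (simp add: x_def algebra_simps)
qed

text \<open>The first products supply the indices above \<open>a\<close> of the alternating
  convolution of total degree \<open>a + b\<close>, the second those below \<open>a\<close>, and
  \<open>l = 0\<close> supplies \<open>a\<close> itself from both. All carry the factor
  \<open>2 * (-1) ^ a\<close>, so the sum vanishes as \<open>a + b > 0\<close>.\<close>

lemma creation_coeff_exchange:
  assumes "a > 0" "b > 0" "a \<le> L" "b \<le> L"
  shows "(\<Sum>l\<le>L. smul (qcoef (-1) l)
    (creation_coeff (int a + int l) * creation_coeff (int b - int l) +
     creation_coeff (int b + int l) * creation_coeff (int a - int l))) = 0"
proof -
  define C where "C = fps_nth creation_part"
  define s where "s x = (-1) ^ x * (C x * C (a + b - x))" for x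
  have qc: "smul (qcoef (-1) l) x = (if l = 0 then x else 2 * ((-1) ^ l * x))" for l x
    by (cases "even l") (auto simp: qcoef_def smul_of_nat[of 2, simplified] smul_uminus_left)
  have pc: "creation_coeff (int a + int l) = C (a + l)" "creation_coeff (int b + int l) = C (b + l)" for l
    by (simp_all add: creation_coeff_def C_def nat_add_distrib)
  have mc: "creation_coeff (int a - int l) = (if l \<le> a then C (a - l) else 0)"
     "creation_coeff (int b - int l) = (if l \<le> b then C (b - l) else 0)" for l
    by (auto simp: creation_coeff_def C_def nat_diff_distrib)
  have split: "sum h {..L} = h 0 + sum h {1..L}" for h :: "nat \<Rightarrow> gamma"
    by (simp add: sum.atLeast1_atMost_eq atMost_atLeast0 sum.atLeast_Suc_atMost)
  have 1: "(\<Sum>l=1..L. (-1) ^ l * (C (a + l) * (if l \<le> b then C (b - l) else 0))) = (-1) ^ a * (\<Sum>x\<in>{a<..a+b}. s x)"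
  proof -
    have "(\<Sum>l=1..L. (-1) ^ l * (C (a + l) * (if l \<le> b then C (b - l) else 0))) = (\<Sum>l=1..b. (-1) ^ l * (C (a + l) * C (b - l)))"
      using assms by (intro sum.mono_neutral_cong_right) auto
    also have "\<dots> = (\<Sum>x\<in>{a<..a+b}. (-1) ^ a * s x)"
    proof (rule sum.reindex_bij_witness[of _ "\<lambda>x. x - a" "\<lambda>l. a + l"])
      fix l assume "l \<in> {1..b}"
      have "(-1::gamma) ^ a * (-1) ^ (a + l) = (-1) ^ l"
        by (simp add: power_add flip: mult.assoc power_mult_distrib)
      then show "(-1) ^ a * s (a + l) = (-1) ^ l * (C (a + l) * C (b - l))"
        by (simp add: s_def flip: mult.assoc)
    qed auto
    finally show ?thesis by (simp add: sum_distrib_left)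
  qed
  have 2: "(\<Sum>l=1..L. (-1) ^ l * (C (b + l) * (if l \<le> a then C (a - l) else 0))) = (-1) ^ a * (\<Sum>x<a. s x)"
  proof -
    have "(\<Sum>l=1..L. (-1) ^ l * (C (b + l) * (if l \<le> a then C (a - l) else 0))) = (\<Sum>l=1..a. (-1) ^ l * (C (b + l) * C (a - l)))"
      using assms by (intro sum.mono_neutral_cong_right) auto
    also have "\<dots> = (\<Sum>x<a. (-1) ^ a * s x)"
    proof (rule sum.reindex_bij_witness[of _ "\<lambda>x. a - x" "\<lambda>l. a - l"])
      fix l assume l: "l \<in> {1..a}"
      then have sgn: "(-1::gamma) ^ a * (-1) ^ (a - l) = (-1) ^ l"
        by (simp add: minus_one_power_iff)
      have idx: "a + b - (a - l) = b + l" using l by auto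
      have "(-1) ^ a * s (a - l) = ((-1) ^ a * (-1) ^ (a - l)) * (C (a - l) * C (b + l))"
        unfolding s_def idx by (rule mult.assoc [symmetric])
      then show "(-1) ^ a * s (a - l) = (-1) ^ l * (C (b + l) * C (a - l))"
        unfolding sgn by (simp only: mult.commute[of "C (a - l)"])
    qed auto
    finally show ?thesis by (simp add: sum_distrib_left)
  qed
  have 3: "(\<Sum>x\<le>a+b. s x) = (\<Sum>x<a. s x) + s a + (\<Sum>x\<in>{a<..a+b}. s x)"
  proof -
    have "{..a+b} = ({..<a} \<union> {a}) \<union> {a<..a+b}" by auto
    moreover have "sum s (({..<a} \<union> {a}) \<union> {a<..a+b}) = sum s ({..<a} \<union> {a}) + sum s {a<..a+b}"
      by (rule sum.union_disjoint) auto
    moreover have "sum s ({..<a} \<union> {a}) = sum s {..<a} + sum s {a}"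
      by (rule sum.union_disjoint) auto
    ultimately show ?thesis by simp
  qed
  have 4: "C a * C b = (-1) ^ a * s a"
    by (simp add: s_def flip: mult.assoc power_mult_distrib)
  have "(\<Sum>l\<le>L. smul (qcoef (-1) l)
    (creation_coeff (int a + int l) * creation_coeff (int b - int l) +
     creation_coeff (int b + int l) * creation_coeff (int a - int l))) =
    2 * (C a * C b) + (\<Sum>l=1..L. 2 * ((-1) ^ l * (C (a + l) * (if l \<le> b then C (b - l) else 0)))
      + 2 * ((-1) ^ l * (C (b + l) * (if l \<le> a then C (a - l) else 0))))"
    unfolding split qc pc mc by (auto simp: distrib_left intro!: arg_cong2[of _ _ _ _ "(+)"] sum.cong)
  also have "\<dots> = 2 * (C a * C b) + (2 * ((-1) ^ a * (\<Sum>x\<in>{a<..a+b}. s x)) + 2 * ((-1) ^ a * (\<Sum>x<a. s x)))"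
    unfolding sum.distrib sum_distrib_left[symmetric] 1 2 ..
  also have "\<dots> = 2 * (-1) ^ a * (\<Sum>x\<le>a+b. s x)"
    unfolding 3 4 by (simp add: algebra_simps)
  also have "\<dots> = 0"
    using creation_part_alternating_convolution[of "a + b"] assms by (simp add: s_def C_def)
  finally show ?thesis .
qed

text \<open>Normal ordering: the outer annihilation part is moved past the inner creation
  coefficient, at the cost of a shift by \<open>l\<close>. The ranges form a fixed box, because
  \<open>l > L\<close> makes the second creation index negative.\<close>

lemma Q_op_Q_op_expand:
  fixes m n N L :: nat
  assumes N: "\<forall>k>N. annihilation_part (\<lambda>n. -1) k f = 0" and L: "n + N \<le> L"
  shows "Q_op (int m) (Q_op (int n) f) = (\<Sum>j\<le>N. \<Sum>i\<le>N. \<Sum>l\<le>L.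
    smul (qcoef (-1) l) (creation_coeff (int (m + j) + int l) * creation_coeff (int (n + i) - int l)) *
      annihilation_part (\<lambda>n. -1) i (annihilation_part (\<lambda>n. -1) j f))"
proof -
  let ?E = "annihilation_part (\<lambda>n. -1)"
  define h where "h l j = (\<Sum>i\<le>N. smul (qcoef (-1) l)
     (creation_coeff (int (m + j) + int l) * creation_coeff (int (n + i) - int l)) * ?E i (?E j f))" for l j
  have N': "\<forall>k>N. ?E k (?E j f) = 0" for j
    using N by (simp add: annihilation_part_commute[of "\<lambda>n. -1" _ "\<lambda>n. -1" j])
  obtain M where M: "\<forall>k>M. ?E k (Q_op (int n) f) = 0"
    using annihilation_part_eventually_0 by blast
  \<comment> \<open>Large enough both to truncate the outer operator and to make the triangle
    \<open>l + j <= K\<close> contain the box.\<close>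
  define K where "K = max M (N + L)"
  have K: "\<forall>k>K. ?E k (vertex_op (\<lambda>n. -1) (int n) f) = 0"
    using M by (simp add: K_def Q_op_def)
  have h0: "h l j = 0" if "j > N \<or> l > L" for l j
    using that
  proof
    assume "l > L"
    then have "creation_coeff (int (n + i) - int l) = 0" if "i \<le> N" for i
      using that L by (simp add: creation_coeff_def)
    then show ?thesis unfolding h_def by (intro sum.neutral) simp
  qed (simp add: h_def N)
  have "Q_op (int m) (Q_op (int n) f) = (\<Sum>k\<le>K. creation_coeff (int m + int k) *
     (\<Sum>l\<le>k. smul (qcoef (-1) l) (\<Sum>i\<le>N. creation_coeff (int n - int l + int i) * ?E i (?E (k - l) f))))"
    unfolding Q_op_def vertex_op_eq[OF K]
    by (subst annihilation_part_vertex_op[of _ "-1"]) (simp_all add: vertex_op_eq[OF N'])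
  also have "\<dots> = (\<Sum>k\<le>K. \<Sum>l\<le>k. h l (k - l))"
  proof (intro sum.cong[OF refl])
    fix k assume "k \<in> {..K}"
    show "creation_coeff (int m + int k) * (\<Sum>l\<le>k. smul (qcoef (-1) l)
       (\<Sum>i\<le>N. creation_coeff (int n - int l + int i) * ?E i (?E (k - l) f))) = (\<Sum>l\<le>k. h l (k - l))"
      unfolding sum_distrib_left
    proof (rule sum.cong[OF refl])
      fix l assume "l \<in> {..k}"
      then have "int (m + (k - l)) + int l = int m + int k" by auto
      then show "creation_coeff (int m + int k) * smul (qcoef (-1) l)
         (\<Sum>i\<le>N. creation_coeff (int n - int l + int i) * ?E i (?E (k - l) f)) = h l (k - l)"
        by (simp add: h_def smul_mult_left smul_mult_right smul_sum sum_distrib_left mult.assoc diff_add_eq)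
    qed
  qed
  also have "\<dots> = (\<Sum>(l, j) | l + j \<le> K. h l j)"
    by (rule sum.triangle_reindex_eq[symmetric])
  also have "\<dots> = (\<Sum>(l, j) \<in> {..L} \<times> {..N}. h l j)"
  proof (rule sum.mono_neutral_right)
    have "{(l, j). l + j \<le> K} \<subseteq> {..K} \<times> {..K}" by auto
    then show "finite {(l, j). l + j \<le> K}" by (rule finite_subset) auto
    show "{..L} \<times> {..N} \<subseteq> {(l, j). l + j \<le> K}" by (auto simp: K_def)
    show "\<forall>x\<in>{(l, j). l + j \<le> K} - {..L} \<times> {..N}. (case x of (l, j) \<Rightarrow> h l j) = 0"
      by (auto intro!: h0)
  qed
  also have "\<dots> = (\<Sum>l\<le>L. \<Sum>j\<le>N. h l j)"
    by (rule sum.cartesian_product[symmetric])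
  also have "\<dots> = (\<Sum>j\<le>N. \<Sum>l\<le>L. h l j)"
    by (rule sum.swap)
  also have "\<dots> = (\<Sum>j\<le>N. \<Sum>i\<le>N. \<Sum>l\<le>L. smul (qcoef (-1) l)
     (creation_coeff (int (m + j) + int l) * creation_coeff (int (n + i) - int l)) * ?E i (?E j f))"
    unfolding h_def by (rule sum.cong[OF refl sum.swap])
  finally show ?thesis .
qed

text \<open>In normal order the annihilation parts commute, so after renaming \<open>i\<close> and
  \<open>j\<close> both products have the same right factors. For each pair the creation parts
  cancel by the exchange identity at \<open>m + j\<close> and \<open>n + i\<close>.\<close>

lemma Q_op_anticommute:
  fixes m n :: nat
  assumes "m > 0" "n > 0"
  shows "Q_op (int m) (Q_op (int n) f) = - Q_op (int n) (Q_op (int m) f)"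
proof -
  let ?E = "annihilation_part (\<lambda>n. -1)"
  obtain N where N: "\<forall>k>N. ?E k f = 0"
    using annihilation_part_eventually_0 by blast
  define L where "L = m + n + N"
  have L: "n + N \<le> L" "m + N \<le> L" by (auto simp: L_def)
  define T where "T a b l = smul (qcoef (-1) l) (creation_coeff (int a + int l) * creation_coeff (int b - int l))" for a b l
  have "Q_op (int n) (Q_op (int m) f) = (\<Sum>j\<le>N. \<Sum>i\<le>N. \<Sum>l\<le>L. T (n + j) (m + i) l * ?E i (?E j f))"
    unfolding T_def by (rule Q_op_Q_op_expand[OF N L(2)])
  also have "\<dots> = (\<Sum>i\<le>N. \<Sum>j\<le>N. \<Sum>l\<le>L. T (n + j) (m + i) l * ?E i (?E j f))"
    by (rule sum.swap)
  also have "\<dots> = (\<Sum>j\<le>N. \<Sum>i\<le>N. \<Sum>l\<le>L. T (n + i) (m + j) l * ?E i (?E j f))"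
    by (simp only: annihilation_part_commute)
  finally have 1: "Q_op (int n) (Q_op (int m) f) = \<dots>" .
  have 2: "Q_op (int m) (Q_op (int n) f) = (\<Sum>j\<le>N. \<Sum>i\<le>N. \<Sum>l\<le>L. T (m + j) (n + i) l * ?E i (?E j f))"
    unfolding T_def by (rule Q_op_Q_op_expand[OF N L(1)])
  have "Q_op (int m) (Q_op (int n) f) + Q_op (int n) (Q_op (int m) f) =
    (\<Sum>j\<le>N. \<Sum>i\<le>N. (\<Sum>l\<le>L. T (m + j) (n + i) l + T (n + i) (m + j) l) * ?E i (?E j f))"
    unfolding 1 2 by (simp only: sum.distrib[symmetric] distrib_right[symmetric] sum_distrib_right)
  also have "\<dots> = 0"
  proof (intro sum.neutral ballI)
    fix j i assume "j \<in> {..N}" "i \<in> {..N}"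
    then have "(\<Sum>l\<le>L. T (m + j) (n + i) l + T (n + i) (m + j) l) = 0"
      using creation_coeff_exchange[of "m + j" "n + i" L] assms L by (simp add: T_def smul_add_right)
    then show "(\<Sum>l\<le>L. T (m + j) (n + i) l + T (n + i) (m + j) l) * ?E i (?E j f) = 0" by simp
  qed
  finally show ?thesis by (rule iffD2[OF eq_neg_iff_add_eq_0])
qed

lemma Q_op_square:
  assumes "m > 0"
  shows "Q_op (int m) (Q_op (int m) f) = 0"
proof -
  have "Q_op (int m) (Q_op (int m) f) + Q_op (int m) (Q_op (int m) f) = 0"
    by (rule iffD1[OF eq_neg_iff_add_eq_0 Q_op_anticommute[OF assms assms]])
  then have "2 * Q_op (int m) (Q_op (int m) f) = 0"
    by (simp only: mult_2)
  then show ?thesis by simp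
qed

text \<open>From \<open>t^n - 1 = -1 + t^n\<close> the exponential splits into the annihilation part
  of \<open>Q_op\<close> and the rescaled series \<open>A(t w)\<close>.\<close>

lemma annihilation_part_G:
  "annihilation_part (\<lambda>n. t ^ n - 1) k f =
    (\<Sum>i\<le>k. smul (t ^ (k - i)) (annihilation_part (\<lambda>n. -1) i (annih (k - i) f)))"
proof -
  have "(\<lambda>n. t ^ n - 1) = (\<lambda>n. -1 + t ^ n * 1)" by (simp add: fun_eq_iff)
  then show ?thesis
    by (simp only: annihilation_part_compose annihilation_part_scale annihilation_part_smul)
qed

text \<open>The splitting leaves a complete \<open>Q_op\<close> once the powers coming from
  \<open>A(t w)\<close> are absorbed into its index.\<close>

lemma G_op_eq:
  assumes N: "\<forall>k>N. annih k f = 0"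
  shows "G_op n f = (\<Sum>k\<le>N. smul (t ^ k) (Q_op (n + int k) (annih k f)))"
proof -
  let ?E = "annihilation_part (\<lambda>n. -1)"
  obtain M where M: "\<forall>k>M. ?E k f = 0"
    using annihilation_part_eventually_0 by blast
  then have M': "\<forall>k>M. ?E k (annih j f) = 0" for j
    by (simp add: annihilation_part_commute[of "\<lambda>n. -1" _ "\<lambda>n. 1" j])
  obtain K0 where K0: "\<forall>k>K0. annihilation_part (\<lambda>n. t ^ n - 1) k f = 0"
    using annihilation_part_eventually_0 by blast
  define K where "K = max K0 (M + N)"
  have K: "\<forall>k>K. annihilation_part (\<lambda>n. t ^ n - 1) k f = 0"
    using K0 by (simp add: K_def)
  define h where "h i j = smul (t ^ j) (creation_coeff (n + int j + int i) * ?E i (annih j f))" for i j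
  have "G_op n f = (\<Sum>k\<le>K. \<Sum>i\<le>k. h i (k - i))"
    unfolding G_op_def vertex_op_eq[OF K] annihilation_part_G sum_distrib_left
  proof (intro sum.cong[OF refl])
    fix k i :: nat assume "i \<in> {..k}"
    then have "n + int (k - i) + int i = n + int k" by auto
    then show "creation_coeff (n + int k) * smul (t ^ (k - i)) (?E i (annih (k - i) f)) = h i (k - i)"
      by (simp add: h_def smul_mult_right)
  qed
  also have "\<dots> = (\<Sum>(i, j) | i + j \<le> K. h i j)"
    by (rule sum.triangle_reindex_eq[symmetric])
  also have "\<dots> = (\<Sum>(i, j) \<in> {..M} \<times> {..N}. h i j)"
  proof (rule sum.mono_neutral_right)
    have "{(l, j). l + j \<le> K} \<subseteq> {..K} \<times> {..K}" by auto
    then show "finite {(l, j). l + j \<le> K}" by (rule finite_subset) auto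
    show "{..M} \<times> {..N} \<subseteq> {(l, j). l + j \<le> K}" by (auto simp: K_def)
    show "\<forall>x\<in>{(l, j). l + j \<le> K} - {..M} \<times> {..N}. (case x of (l, j) \<Rightarrow> h l j) = 0"
    proof
      fix x assume "x \<in> {(l, j). l + j \<le> K} - {..M} \<times> {..N}"
      moreover obtain i j where x: "x = (i, j)" by (cases x)
      ultimately have "\<not> (i \<le> M \<and> j \<le> N)" by simp
      then have "M < i \<or> N < j" by linarith
      then have "?E i (annih j f) = 0" using M' N by auto
      then show "(case x of (l, j) \<Rightarrow> h l j) = 0" by (simp add: x h_def)
    qed
  qed
  also have "\<dots> = (\<Sum>i\<le>M. \<Sum>j\<le>N. h i j)"
    by (rule sum.cartesian_product[symmetric])
  also have "\<dots> = (\<Sum>j\<le>N. \<Sum>i\<le>M. h i j)"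
    by (rule sum.swap)
  also have "\<dots> = (\<Sum>j\<le>N. smul (t ^ j) (Q_op (n + int j) (annih j f)))"
    unfolding Q_op_def vertex_op_eq[OF M'] h_def smul_sum ..
  finally show ?thesis .
qed


section \<open>Coordinates with respect to the Schur Q-functions\<close>

text \<open>With 0 for the empty list, \<open>first_part xi < n\<close> expresses both strict
  decrease and, for empty \<open>xi\<close>, positivity of \<open>n\<close>.\<close>

definition first_part :: "nat list \<Rightarrow> nat"
  where "first_part xi = (case xi of [] \<Rightarrow> 0 | m # _ \<Rightarrow> m)"

lemma first_part_simps [simp]: "first_part [] = 0" "first_part (m # xi) = m"
  by (simp_all add: first_part_def)

lemma strict_partition_Nil [simp]: "strict_partition []"
  by (simp add: strict_partition_def)

lemma strict_partition_Cons: "strict_partition (n # xi) \<longleftrightarrow> first_part xi < n \<and> strict_partition xi"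
  by (cases xi) (auto simp: strict_partition_def)

lemma schur_Q_Nil [simp]: "schur_Q [] = 1"
  by (simp add: schur_Q_def)

lemma schur_Q_Cons: "schur_Q (n # xi) = Q_op (int n) (schur_Q xi)"
  by (simp add: schur_Q_def)

lemma Q_op_add: "Q_op n (f + g) = Q_op n f + Q_op n g"
  by (simp add: Q_op_def vertex_op_add)

lemma Q_op_smul: "Q_op n (smul c f) = smul c (Q_op n f)"
  by (simp add: Q_op_def vertex_op_smul)

lemma Q_op_zero [simp]: "Q_op n 0 = 0"
  by (simp add: Q_op_def)

lemma Q_op_0_one [simp]: "Q_op 0 1 = 1"
  by (simp add: Q_op_def vertex_op_one creation_coeff_def)

text \<open>Induction on the tail and then on \<open>n\<close>. For \<open>k\<close> beyond the
  parts of the tail the relation lowers \<open>n\<close> and \<open>k\<close> together.\<close>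

lemma annih_schur_Q_ge:
  assumes "strict_partition (n # xi)" "n \<le> k"
  shows "annih k (schur_Q (n # xi)) = (if k = n then smul 2 (schur_Q xi) else 0)"
  using assms
proof (induction xi arbitrary: n k)
  case Nil
  then show ?case
  proof (induction n arbitrary: k)
    case (Suc n)
    then obtain k' where k: "k = Suc k'" using Suc_le_D by blast
    have two: "(1::gamma) + 1 = smul 2 1" using smul_of_nat[of 2 1] by simp
    show ?case
    proof (cases "n = 0")
      case True
      then show ?thesis using two annih_Q_op_Suc[of k' 1 1]
        by (auto simp: schur_Q_Cons k annihilation_part_one)
    next
      case False
      then have "annih k' (schur_Q [n]) = (if k' = n then smul 2 (schur_Q []) else 0)"
        using Suc k by (intro Suc.IH) (auto simp: strict_partition_Cons)
      moreover have "k' \<noteq> 0" using False Suc k by auto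
      ultimately show ?thesis using annih_Q_op_Suc[of k' "int (Suc n)" 1]
        by (simp add: schur_Q_Cons k annihilation_part_one)
    qed
  qed (simp add: strict_partition_Cons)
next
  case (Cons m xi)
  have ge: "annih k (schur_Q (m # xi)) = (if k = m then smul 2 (schur_Q xi) else 0)" if "m \<le> k" for k
    using Cons.IH[of m k] Cons.prems that by (simp add: strict_partition_Cons)
  have m: "m > 0" using Cons.prems by (auto simp: strict_partition_Cons)
  show ?case using Cons.prems
  proof (induction n arbitrary: k)
    case (Suc n)
    then obtain k' where k: "k = Suc k'" using Suc_le_D by blast
    have mn: "m \<le> n" "n \<le> k'" using Suc k by (auto simp: strict_partition_Cons)
    have E: "annih k (schur_Q (Suc n # m # xi)) = annih k' (Q_op (int n) (schur_Q (m # xi))) +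
        Q_op (int (Suc n)) (annih k (schur_Q (m # xi))) + Q_op (int n) (annih k' (schur_Q (m # xi)))"
      using annih_Q_op_Suc[of k' "int (Suc n)" "schur_Q (m # xi)"] by (simp add: schur_Q_Cons[of "Suc n"] k)
    have z: "annih k (schur_Q (m # xi)) = 0" using ge[of k] mn k by simp
    show ?case
    proof (cases "n = m")
      case True
      \<comment> \<open>The descent ends at the next part: the first term dies because
        \<open>Q_m\<close> squares to 0, and the last term produces the factor 2.\<close>
      have "Q_op (int n) (schur_Q (m # xi)) = 0"
        using True Q_op_square[OF m] by (simp add: schur_Q_Cons)
      then show ?thesis unfolding E z using True ge[of k'] mn k
        by (auto simp: Q_op_smul schur_Q_Cons)
    next
      case False
      then have "annih k' (schur_Q (n # m # xi)) = (if k' = n then smul 2 (schur_Q (m # xi)) else 0)"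
        using Suc mn by (intro Suc.IH) (auto simp: strict_partition_Cons)
      moreover have "annih k' (schur_Q (m # xi)) = 0" using ge[of k'] mn False by simp
      ultimately show ?thesis unfolding E z using k by (simp add: schur_Q_Cons[of n])
    qed
  qed (simp add: strict_partition_Cons)
qed

lemma annih_schur_Q_gt:
  assumes "strict_partition xi" "first_part xi < k"
  shows "annih k (schur_Q xi) = 0"
  using assms annih_schur_Q_ge by (cases xi) (auto simp: annihilation_part_one)

text \<open>Induction on the largest part allowed: first the coefficients with part
  \<open>Suc N\<close> are shown to vanish, then the remaining relation falls under the induction
  hypothesis again.\<close>

lemma schur_Q_family_independent_bounded:
  assumes "finite S" "\<And>xi. xi \<in> S \<Longrightarrow> strict_partition xi \<and> first_part xi \<le> N"
    "(\<Sum>xi\<in>S. smul (a xi) (schur_Q xi)) = 0"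
  shows "\<forall>xi\<in>S. a xi = 0"
  using assms
proof (induction N arbitrary: S a)
  case 0
  have "xi = []" if "xi \<in> S" for xi
    using 0(2)[OF that] by (cases xi) (auto simp: strict_partition_Cons)
  then have "S = {} \<or> S = {[]}" by auto
  then show ?case using 0(3) by (auto simp: smul_def dest: arg_cong[of _ _ "\<lambda>f. Poly_Mapping.lookup f 0"])
next
  case (Suc N)
  define T where "T = {xi \<in> S. first_part xi = Suc N}"
  define U where "U = {xi \<in> S. first_part xi \<le> N}"
  have S: "S = T \<union> U" "T \<inter> U = {}" "finite T" "finite U"
    using Suc.prems(1,2) by (auto simp: T_def U_def le_Suc_eq)
  have T: "xi = Suc N # tl xi" "strict_partition (tl xi)" "first_part (tl xi) \<le> N" if "xi \<in> T" for xi
    using that Suc.prems(2)[of xi] by (cases xi; auto simp: T_def strict_partition_Cons)+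
  have inj: "inj_on tl T" using T(1) by (metis inj_onI)
  \<comment> \<open>\<open>annih (Suc N)\<close> kills the functions in \<open>U\<close> and strips
    the first part from those in \<open>T\<close>, so a relation with parts at most \<open>N\<close>
    remains.\<close>
  have "0 = (\<Sum>xi\<in>S. smul (a xi) (annih (Suc N) (schur_Q xi)))"
    using arg_cong[OF Suc.prems(3), of "annih (Suc N)"] by (simp add: annihilation_part_sum annihilation_part_smul)
  also have "\<dots> = (\<Sum>xi\<in>T. smul (a xi) (smul 2 (schur_Q (tl xi))))"
  proof (rule sum.mono_neutral_cong_right)
    show "\<forall>xi\<in>S - T. smul (a xi) (annih (Suc N) (schur_Q xi)) = 0"
      using S Suc.prems(2) by (auto simp: U_def annih_schur_Q_gt)
    show "smul (a xi) (annih (Suc N) (schur_Q xi)) = smul (a xi) (smul 2 (schur_Q (tl xi)))" if "xi \<in> T" for xi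
      using T(1)[OF that] annih_schur_Q_ge[of "Suc N" "tl xi" "Suc N"] that Suc.prems(2)[of xi]
      by (metis (mono_tags, lifting) S(1) UnI1 order_refl)
  qed (use S in auto)
  also have "\<dots> = (\<Sum>xi\<in>tl ` T. smul (2 * a (Suc N # xi)) (schur_Q xi))"
    unfolding sum.reindex[OF inj] using T(1) by (intro sum.cong[OF refl]) (simp add: smul_smul mult.commute)
  finally have "\<forall>xi\<in>tl ` T. 2 * a (Suc N # xi) = 0"
    using S T by (intro Suc.IH) auto
  then have aT: "a xi = 0" if "xi \<in> T" for xi using T(1)[OF that] that by (metis image_eqI mult_eq_0_iff zero_neq_numeral)
  have "(\<Sum>xi\<in>S. smul (a xi) (schur_Q xi)) = (\<Sum>xi\<in>U. smul (a xi) (schur_Q xi))"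
    using S aT by (intro sum.mono_neutral_right) auto
  then have U0: "(\<Sum>xi\<in>U. smul (a xi) (schur_Q xi)) = 0"
    by (simp only: Suc.prems(3))
  have "\<forall>xi\<in>U. a xi = 0"
    by (rule Suc.IH[OF S(4) _ U0]) (use Suc.prems(2) in \<open>auto simp: U_def\<close>)
  then show ?case using S aT by auto
qed

lemma schur_Q_family_independent:
  assumes S: "finite S" "S \<subseteq> Collect strict_partition"
    and "(\<Sum>xi\<in>S. smul (a xi) (schur_Q xi)) = 0" and "xi \<in> S"
  shows "a xi = 0"
proof -
  have "first_part xi \<le> (\<Sum>xi\<in>S. first_part xi)" if "xi \<in> S" for xi
    using S that by (meson member_le_sum zero_le)
  then show ?thesis
    using schur_Q_family_independent_bounded[OF S(1)] assms by blast
qed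

section \<open>Linear algebra of the ring and coordinate functionals\<close>

interpretation gamma: vector_space smul
  by unfold_locales (auto simp: smul_add_right smul_add_left smul_smul)

text \<open>A coincidence would be a relation with coefficients 1 and -1. Injectivity lets
  independence pass from indexed families to the set of values.\<close>

lemma inj_on_schur_Q: "inj_on schur_Q (Collect strict_partition)"
proof (rule inj_onI, rule ccontr)
  fix xi nu assume *: "xi \<in> Collect strict_partition" "nu \<in> Collect strict_partition" "schur_Q xi = schur_Q nu" "xi \<noteq> nu"
  then have "(\<Sum>x\<in>{xi, nu}. smul (if x = xi then 1 else -1) (schur_Q x)) = 0"
    by (simp add: smul_uminus_left)
  from schur_Q_family_independent[OF _ _ this, of xi] * show False by simp
qed

definition schur_Q_basis :: "gamma set"
  where "schur_Q_basis = schur_Q ` Collect strict_partition"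

lemma independent_schur_Q_basis: "gamma.independent schur_Q_basis"
  unfolding gamma.independent_explicit_finite_subsets
proof (intro allI impI)
  fix B u assume B: "B \<subseteq> schur_Q_basis" "finite B" "(\<Sum>v\<in>B. smul (u v) v) = 0"
  then obtain S where S: "S \<subseteq> Collect strict_partition" "B = schur_Q ` S"
    unfolding schur_Q_basis_def by (meson subset_imageE)
  have inj: "inj_on schur_Q S" using S inj_on_schur_Q inj_on_subset by blast
  then have "finite S" using B S finite_imageD by blast
  moreover have "(\<Sum>xi\<in>S. smul (u (schur_Q xi)) (schur_Q xi)) = 0"
    using B(3) unfolding S(2) sum.reindex[OF inj] by (simp add: o_def)
  ultimately show "\<forall>v\<in>B. u v = 0"
    using schur_Q_family_independent[of S "\<lambda>xi. u (schur_Q xi)"] S by auto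
qed

text \<open>Extending the \<open>schur_Q lam\<close> to a basis makes the coordinates linear on the whole space.\<close>

definition schur_coord :: "nat list \<Rightarrow> gamma \<Rightarrow> ratfun"
  where "schur_coord lam f = gamma.representation (gamma.extend_basis schur_Q_basis) f (schur_Q lam)"

lemma schur_coord_add: "schur_coord lam (f + g) = schur_coord lam f + schur_coord lam g"
  by (simp add: schur_coord_def gamma.representation_add independent_schur_Q_basis
      gamma.independent_extend_basis gamma.span_extend_basis)

lemma schur_coord_smul: "schur_coord lam (smul c f) = c * schur_coord lam f"
  by (simp add: schur_coord_def gamma.representation_scale independent_schur_Q_basis
      gamma.independent_extend_basis gamma.span_extend_basis)

lemma schur_coord_zero [simp]: "schur_coord lam 0 = 0"
  using schur_coord_smul[of lam 0 0] by simp

lemma schur_coord_uminus: "schur_coord lam (- f) = - schur_coord lam f"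
  using schur_coord_smul[of lam "-1" f] by (simp add: smul_uminus_left)

lemma schur_coord_sum: "schur_coord lam (\<Sum>x\<in>A. f x) = (\<Sum>x\<in>A. schur_coord lam (f x))"
  by (induction A rule: infinite_finite_induct) (auto simp: schur_coord_add)

lemma schur_coord_schur_Q:
  assumes "strict_partition lam" "strict_partition nu"
  shows "schur_coord lam (schur_Q nu) = (if lam = nu then 1 else 0)"
proof -
  have "schur_Q nu \<in> gamma.extend_basis schur_Q_basis"
    using assms gamma.extend_basis_superset[OF independent_schur_Q_basis] by (auto simp: schur_Q_basis_def)
  then have "schur_coord lam (schur_Q nu) = (if schur_Q lam = schur_Q nu then 1 else 0)"
    by (simp add: schur_coord_def gamma.representation_basis independent_schur_Q_basis gamma.independent_extend_basis)
  then show ?thesis using inj_onD[OF inj_on_schur_Q] assms by auto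
qed

text \<open>A filtration by the largest part: on level \<open>m <= n\<close> with
  \<open>n > 0\<close>, \<open>Q_op (int n)\<close> just prepends \<open>n\<close> or gives
  0.\<close>

definition schur_span :: "nat \<Rightarrow> gamma set"
  where "schur_span m = gamma.span (schur_Q ` {xi. strict_partition xi \<and> first_part xi \<le> m})"

lemma schur_span_mono: "m \<le> n \<Longrightarrow> f \<in> schur_span m \<Longrightarrow> f \<in> schur_span n"
  unfolding schur_span_def by (rule subsetD[OF gamma.span_mono]) auto

lemma schur_span_induct [consumes 1, case_names zero add smul schur_Q]:
  assumes "f \<in> schur_span m" "P 0" "\<And>f g. P f \<Longrightarrow> P g \<Longrightarrow> P (f + g)" "\<And>c f. P f \<Longrightarrow> P (smul c f)"
    "\<And>xi. strict_partition xi \<Longrightarrow> first_part xi \<le> m \<Longrightarrow> P (schur_Q xi)"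
  shows "P f"
  by (rule gamma.span_induct[OF assms(1)[unfolded schur_span_def]])
    (use assms in \<open>auto simp: gamma.subspace_def\<close>)

lemma schur_span_add: "f \<in> schur_span m \<Longrightarrow> g \<in> schur_span m \<Longrightarrow> f + g \<in> schur_span m"
  by (simp add: schur_span_def gamma.span_add)

lemma schur_span_smul: "f \<in> schur_span m \<Longrightarrow> smul c f \<in> schur_span m"
  by (simp add: schur_span_def gamma.span_scale)

lemma schur_span_uminus: "f \<in> schur_span m \<Longrightarrow> - f \<in> schur_span m"
  by (simp add: schur_span_def gamma.span_neg)

lemma schur_span_zero [simp]: "0 \<in> schur_span m"
  by (simp add: schur_span_def gamma.span_zero)

lemma schur_Q_in_schur_span: "strict_partition xi \<Longrightarrow> first_part xi \<le> m \<Longrightarrow> schur_Q xi \<in> schur_span m"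
  by (simp add: schur_span_def gamma.span_base)

text \<open>Supplies the existence half of the description used in \<open>Q_Kostka\<close>.\<close>

lemma schur_span_expansion:
  assumes "f \<in> schur_span m"
  obtains L :: "nat list \<Rightarrow>\<^sub>0 ratfun" where "\<forall>nu\<in>Poly_Mapping.keys L. strict_partition nu"
    "f = (\<Sum>nu\<in>Poly_Mapping.keys L. smul (Poly_Mapping.lookup L nu) (schur_Q nu))"
proof -
  define ex where "ex L = (\<Sum>nu\<in>Poly_Mapping.keys L. smul (Poly_Mapping.lookup L nu) (schur_Q nu))" for L :: "nat list \<Rightarrow>\<^sub>0 ratfun"
  \<comment> \<open>Summation over any finite superset of the support allows expansions with
    different supports to be added.\<close>
  have ex: "ex L = (\<Sum>nu\<in>S. smul (Poly_Mapping.lookup L nu) (schur_Q nu))" if "finite S" "Poly_Mapping.keys L \<subseteq> S" for L S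
    unfolding ex_def using that by (intro sum.mono_neutral_left) (auto simp: in_keys_iff)
  have "\<exists>L. (\<forall>nu\<in>Poly_Mapping.keys L. strict_partition nu) \<and> f = ex L"
    using assms
  proof (induction f rule: schur_span_induct)
    case zero
    show ?case by (intro exI[of _ 0]) (simp add: ex_def)
  next
    case (add f g)
    then obtain L M where L: "\<forall>nu\<in>Poly_Mapping.keys L. strict_partition nu" "f = ex L"
      and M: "\<forall>nu\<in>Poly_Mapping.keys M. strict_partition nu" "g = ex M" by blast
    have "ex (L + M) = ex L + ex M"
      using Poly_Mapping.keys_add[of L M]
      by (simp add: ex[of "Poly_Mapping.keys L \<union> Poly_Mapping.keys M"] lookup_add smul_add_left sum.distrib)
    moreover have "\<forall>nu\<in>Poly_Mapping.keys (L + M). strict_partition nu"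
      using L(1) M(1) Poly_Mapping.keys_add[of L M] by (meson UnE subsetD)
    ultimately show ?case using L(2) M(2) by (intro exI[of _ "L + M"]) simp
  next
    case (smul c f)
    then obtain L where L: "\<forall>nu\<in>Poly_Mapping.keys L. strict_partition nu" "f = ex L" by blast
    have lookup_map: "Poly_Mapping.lookup (Poly_Mapping.map ((*) c) L) nu = c * Poly_Mapping.lookup L nu" for nu
      by (simp add: map.rep_eq when_def)
    have keys: "Poly_Mapping.keys (Poly_Mapping.map ((*) c) L) \<subseteq> Poly_Mapping.keys L"
      by (auto simp: in_keys_iff map.rep_eq)
    then have "ex (Poly_Mapping.map ((*) c) L) = smul c (ex L)"
      by (simp add: ex[of "Poly_Mapping.keys L"] lookup_map smul_sum smul_smul)
    moreover have "\<forall>nu\<in>Poly_Mapping.keys (Poly_Mapping.map ((*) c) L). strict_partition nu"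
      using L(1) keys by (meson subsetD)
    ultimately show ?case using L(2) by (intro exI[of _ "Poly_Mapping.map ((*) c) L"]) simp
  next
    case (schur_Q xi)
    then show ?case by (intro exI[of _ "Poly_Mapping.single xi 1"]) (simp add: ex_def)
  qed
  then show ?thesis using that by (auto simp: ex_def)
qed

text \<open>The family in the definition exists by the span hypothesis and is unique because its
  entries are coordinates, or 0 at lists that are not strict.\<close>

lemma Q_Kostka_eq_schur_coord:
  assumes G: "hall_littlewood_G mu \<in> schur_span m" and lam: "strict_partition lam"
  shows "Q_Kostka lam mu = schur_coord lam (hall_littlewood_G mu)"
proof -
  let ?P = "\<lambda>L. (\<forall>nu\<in>Poly_Mapping.keys L. strict_partition nu) \<and>
         hall_littlewood_G mu = (\<Sum>nu\<in>Poly_Mapping.keys L. smul (Poly_Mapping.lookup L nu) (schur_Q nu))"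
  have co: "Poly_Mapping.lookup L nu = schur_coord nu (hall_littlewood_G mu)" if L: "?P L" and nu: "strict_partition nu" for L nu
  proof -
    have "schur_coord nu (hall_littlewood_G mu) = (\<Sum>xi\<in>Poly_Mapping.keys L. if nu = xi then Poly_Mapping.lookup L xi else 0)"
      unfolding conjunct2[OF L] schur_coord_sum schur_coord_smul
      by (rule sum.cong[OF refl]) (use L nu in \<open>auto simp: schur_coord_schur_Q\<close>)
    then show ?thesis by (simp add: in_keys_iff)
  qed
  obtain L where L: "?P L" using schur_span_expansion[OF G] by metis
  have "M = L" if M: "?P M" for M
  proof (rule poly_mapping_eqI)
    fix nu
    show "Poly_Mapping.lookup M nu = Poly_Mapping.lookup L nu"
    proof (cases "strict_partition nu")
      case True
      then show ?thesis using co[OF M] co[OF L] by simp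
    next
      case False
      then have "nu \<notin> Poly_Mapping.keys M" "nu \<notin> Poly_Mapping.keys L" using L M by auto
      then show ?thesis by (simp add: in_keys_iff)
    qed
  qed
  then have "(THE L. ?P L) = L" using L by (intro the_equality)
  then show ?thesis unfolding Q_Kostka_def using co[OF L lam] by simp
qed


section \<open>Operators in coordinates\<close>

text \<open>On basis elements the operator prepends \<open>n\<close>, or gives 0 if \<open>n\<close>
  is already the first part.\<close>

lemma Q_op_schur_span_coord:
  assumes "f \<in> schur_span m" "m \<le> n" "n > 0"
  shows "Q_op (int n) f \<in> schur_span n \<and> (\<forall>nu. strict_partition nu \<longrightarrow>
    schur_coord nu (Q_op (int n) f) = (if nu \<noteq> [] \<and> hd nu = n then schur_coord (tl nu) f else 0))"
  using assms(1)
proof (induction f rule: schur_span_induct)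
  case (schur_Q eta)
  show ?case
  proof (cases "first_part eta = n")
    case True
    then obtain eta' where eta: "eta = n # eta'" using assms(3) by (cases eta) auto
    \<comment> \<open>A strict \<open>nu\<close> starting with \<open>n\<close> has a tail with
      smaller parts, so the annihilated \<open>eta\<close> is invisible to this coordinate.\<close>
    have "schur_coord (tl nu) (schur_Q eta) = 0" if "strict_partition nu" "nu \<noteq> []" "hd nu = n" for nu
      using that schur_Q eta by (cases nu) (auto simp: strict_partition_Cons schur_coord_schur_Q)
    then show ?thesis using Q_op_square[OF assms(3)] by (simp add: eta schur_Q_Cons)
  next
    case False
    then have st: "strict_partition (n # eta)" using schur_Q assms(2) by (simp add: strict_partition_Cons)
    have "schur_coord nu (schur_Q (n # eta)) = (if nu \<noteq> [] \<and> hd nu = n then schur_coord (tl nu) (schur_Q eta) else 0)"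
      if "strict_partition nu" for nu
      using that schur_Q st by (cases nu) (auto simp: strict_partition_Cons schur_coord_schur_Q)
    then show ?thesis using schur_Q_in_schur_span[OF st] by (simp add: schur_Q_Cons)
  qed
qed (auto simp: Q_op_add Q_op_smul schur_coord_add schur_coord_smul schur_span_add schur_span_smul)

lemmas Q_op_schur_span = Q_op_schur_span_coord[THEN conjunct1]
lemmas schur_coord_Q_op = Q_op_schur_span_coord[THEN conjunct2, rule_format]

text \<open>
  For strict \<open>xi\<close> and \<open>nu\<close> this is \<open>2 ^ strip_a xi nu\<close> if \<open>xi/nu\<close> is a horizontal strip, and \<open>0\<close>
  otherwise. The boxes in columns \<open>v + 1, \<dots>, n\<close> of the top row contribute a new end \<open>n\<close>; but if
  \<open>v = first_part xi\<close>, then the strip has a box in column \<open>v\<close> of the row below (as \<open>nu\<close> is strict),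
  which ceases to be an end.
\<close>

fun strip_weight :: "nat list \<Rightarrow> nat list \<Rightarrow> ratfun"
  where
    "strip_weight [] [] = 1"
  | "strip_weight [] (v # nu) = 0"
  | "strip_weight (n # xi) [] = (if xi = [] then 2 else 0)"
  | "strip_weight (n # xi) (v # nu) = (if v \<le> n \<and> first_part xi \<le> v
      then (if v = n \<or> v = first_part xi then 1 else 2) * strip_weight xi nu else 0)"

text \<open>A nonzero weight forces \<open>nu\<close> below \<open>xi\<close> row by row. This
  settles \<open>k = 0\<close>, where the operator is the identity.\<close>

lemma strip_weight_sum_list:
  assumes "strip_weight xi nu \<noteq> 0" "strict_partition xi"
  shows "sum_list nu \<le> sum_list xi \<and> (sum_list nu = sum_list xi \<longrightarrow> nu = xi)"
  using assms
proof (induction xi nu rule: strip_weight.induct)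
  case (4 n xi v nu)
  then have "v \<le> n" "sum_list nu \<le> sum_list xi \<and> (sum_list nu = sum_list xi \<longrightarrow> nu = xi)"
    by (auto simp: strict_partition_Cons split: if_splits)
  then show ?case by auto
qed (auto simp: strict_partition_Cons split: if_splits)

lemma strip_weight_self: "strict_partition xi \<Longrightarrow> strip_weight xi xi = 1"
  by (induction xi) (auto simp: strict_partition_Cons)

text \<open>Induction on \<open>xi\<close> and on its first part, through
  \<open>annih_Q_op_Suc\<close>. Passing from \<open>n\<close> to \<open>Suc n\<close>, the first
  term keeps the weights for \<open>n # xi\<close>, the second covers \<open>v = Suc n\<close>, and
  the third adds 1 at \<open>v = n\<close>, which is no longer the full row.\<close>

lemma annih_schur_Q_coord:
  assumes "strict_partition xi"
  shows "annih k (schur_Q xi) \<in> schur_span (first_part xi) \<and> (\<forall>nu. strict_partition nu \<longrightarrow>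
    schur_coord nu (annih k (schur_Q xi)) = (if sum_list nu + k = sum_list xi then strip_weight xi nu else 0))"
  using assms
proof (induction xi arbitrary: k)
  case Nil
  have "schur_coord nu (annih k (schur_Q [])) = (if sum_list nu + k = sum_list [] then strip_weight [] nu else 0)"
    if "strict_partition nu" for nu
    using that schur_coord_schur_Q[OF that strict_partition_Nil]
    by (cases nu) (auto simp: annihilation_part_one strict_partition_Cons)
  then show ?case using schur_Q_in_schur_span[of "[]" 0] by (auto simp: annihilation_part_one)
next
  case (Cons n xi)
  have xi: "strict_partition xi" using Cons.prems by (simp add: strict_partition_Cons)
  note sp = Cons.IH[OF xi, THEN conjunct1]
  note co = Cons.IH[OF xi, THEN conjunct2, rule_format]
  show ?case using Cons.prems
  proof (induction n arbitrary: k)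
    case 0
    then show ?case by (simp add: strict_partition_Cons)
  next
    case (Suc n)
    have first: "first_part xi \<le> n" using Suc.prems by (simp add: strict_partition_Cons)
    show ?case
    proof (cases k)
      case 0
      have "schur_coord nu (schur_Q (Suc n # xi)) =
        (if sum_list nu = sum_list (Suc n # xi) then strip_weight (Suc n # xi) nu else 0)"
        if nu: "strict_partition nu" for nu
        using strip_weight_self[OF Suc.prems] strip_weight_sum_list[OF _ Suc.prems, of nu]
        by (auto simp: schur_coord_schur_Q[OF nu Suc.prems] simp del: strip_weight.simps)
      then show ?thesis using schur_Q_in_schur_span[OF Suc.prems] by (simp add: 0)
    next
      case k: (Suc k')
      have E: "annih k (schur_Q (Suc n # xi)) = annih k' (Q_op (int n) (schur_Q xi)) +
        Q_op (int (Suc n)) (annih k (schur_Q xi)) + Q_op (int n) (annih k' (schur_Q xi))"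
        using annih_Q_op_Suc[of k' "int (Suc n)" "schur_Q xi"] by (simp add: schur_Q_Cons k)
      have sp2: "Q_op (int (Suc n)) (annih k (schur_Q xi)) \<in> schur_span (Suc n)"
        using first by (intro Q_op_schur_span[OF sp]) auto
      have co2: "schur_coord nu (Q_op (int (Suc n)) (annih k (schur_Q xi))) =
        (if nu \<noteq> [] \<and> hd nu = Suc n then if sum_list (tl nu) + k = sum_list xi then strip_weight xi (tl nu) else 0 else 0)"
        if "strict_partition nu" for nu
        using that first by (subst schur_coord_Q_op[OF sp]) (cases nu; auto simp: co strict_partition_Cons)+
      show ?thesis
      \<comment> \<open>The index 0 is excluded from the coordinate rule for \<open>Q_op\<close>;
        here \<open>xi\<close> is empty and the value is known.\<close>
      proof (cases "n = 0")
        case True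
        then have "xi = []" using first xi by (cases xi) (auto simp: strict_partition_Cons)
        then have A: "annih k (schur_Q (Suc n # xi)) = (if k' = 0 then smul 2 (schur_Q []) else 0)"
          using annih_schur_Q_ge[OF Suc.prems, of k] k True by auto
        have "schur_coord nu (annih k (schur_Q (Suc n # xi))) =
          (if sum_list nu + k = sum_list (Suc n # xi) then strip_weight (Suc n # xi) nu else 0)"
          if "strict_partition nu" for nu
          using that schur_coord_schur_Q[OF that strict_partition_Nil] unfolding A
          by (cases nu) (auto simp: k True \<open>xi = []\<close> schur_coord_smul strict_partition_Cons)
        moreover have "annih k (schur_Q (Suc n # xi)) \<in> schur_span (Suc n)"
          using A by (auto intro!: schur_span_smul schur_Q_in_schur_span simp del: schur_Q_Nil)
        ultimately show ?thesis by auto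
      next
        case n0: False
        have sp3: "Q_op (int n) (annih k' (schur_Q xi)) \<in> schur_span (Suc n)"
          using first n0 by (intro schur_span_mono[OF _ Q_op_schur_span[OF sp]]) auto
        have co3: "schur_coord nu (Q_op (int n) (annih k' (schur_Q xi))) =
          (if nu \<noteq> [] \<and> hd nu = n then if sum_list (tl nu) + k' = sum_list xi then strip_weight xi (tl nu) else 0 else 0)"
          if "strict_partition nu" for nu
          using that first n0 by (subst schur_coord_Q_op[OF sp]) (cases nu; auto simp: co strict_partition_Cons)+
        show ?thesis
        proof (cases "first_part xi = n")
          case True
          then obtain xi' where xi': "xi = n # xi'" using n0 by (cases xi) auto
          \<comment> \<open>The first term is lost, so at \<open>v = n = first_part xi\<close> the
            weight factor is 1 instead of 2.\<close>
          have z: "Q_op (int n) (schur_Q xi) = 0"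
            using Q_op_square[of n] n0 by (simp add: xi' schur_Q_Cons)
          have "schur_coord nu (annih k (schur_Q (Suc n # xi))) =
            (if sum_list nu + k = sum_list (Suc n # xi) then strip_weight (Suc n # xi) nu else 0)"
            if nu: "strict_partition nu" for nu
            unfolding E z schur_coord_add annihilation_part_zero schur_coord_zero co2[OF nu] co3[OF nu]
            using nu True by (cases nu) (auto simp: k xi' simp del: strip_weight.simps(4) simp: strip_weight.simps(4)[of "Suc n"])
          moreover have "annih k (schur_Q (Suc n # xi)) \<in> schur_span (Suc n)"
            unfolding E z by (intro schur_span_add sp2 sp3) simp
          ultimately show ?thesis by auto
        next
          case False
          then have st: "strict_partition (n # xi)" using first xi by (simp add: strict_partition_Cons)
          note IH = Suc.IH[OF st, of k']
          have sp1: "annih k' (Q_op (int n) (schur_Q xi)) \<in> schur_span (Suc n)"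
            using IH schur_span_mono[of n "Suc n"] by (simp add: schur_Q_Cons)
          have co1: "schur_coord nu (annih k' (Q_op (int n) (schur_Q xi))) =
             (if sum_list nu + k' = sum_list (n # xi) then strip_weight (n # xi) nu else 0)" if "strict_partition nu" for nu
            using IH that by (simp add: schur_Q_Cons)
          have "schur_coord nu (annih k (schur_Q (Suc n # xi))) =
            (if sum_list nu + k = sum_list (Suc n # xi) then strip_weight (Suc n # xi) nu else 0)"
            if nu: "strict_partition nu" for nu
            unfolding E schur_coord_add co1[OF nu] co2[OF nu] co3[OF nu]
            using nu first False by (cases nu) (auto simp: k le_Suc_eq)
          moreover have "annih k (schur_Q (Suc n # xi)) \<in> schur_span (Suc n)"
            unfolding E by (intro schur_span_add sp1 sp2 sp3)
          ultimately show ?thesis by auto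
        qed
      qed
    qed
  qed
qed

text \<open>By anticommutation the operator moves past each larger part at the cost of a sign, until
  it meets \<open>a\<close> and vanishes or reaches its place in the decreasing order.\<close>

lemma Q_op_schur_Q_coord:
  assumes "strict_partition eta" "a > 0"
  shows "Q_op (int a) (schur_Q eta) \<in> schur_span (max a (first_part eta)) \<and> (\<forall>lam. strict_partition lam \<longrightarrow>
    schur_coord lam (Q_op (int a) (schur_Q eta)) =
      (if a \<in> set lam \<and> remove1 a lam = eta then (-1) ^ length (filter (\<lambda>x. x > a) lam) else 0))"
  using assms(1)
proof (induction eta)
  case Nil
  have st: "strict_partition [a]" using assms by (simp add: strict_partition_Cons)
  have "a \<in> set lam \<and> remove1 a lam = [] \<longleftrightarrow> lam = [a]" for lam
    by (cases lam) auto
  then show ?case using schur_Q_in_schur_span[OF st, of a] schur_coord_schur_Q[OF _ st]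
    by (auto simp: schur_Q_Cons)
next
  case (Cons b eta)
  then have eta: "strict_partition eta" "first_part eta < b" by (simp_all add: strict_partition_Cons)
  consider "b < a" | "a = b" | "a < b" by linarith
  then show ?case
  proof cases
    case 1
    then have st: "strict_partition (a # b # eta)" using Cons.prems by (simp add: strict_partition_Cons)
    have "(if a \<in> set lam \<and> remove1 a lam = b # eta then (-1) ^ length (filter (\<lambda>x. x > a) lam) else 0)
      = (if lam = a # b # eta then 1 else 0 :: ratfun)" if "strict_partition lam" for lam
    proof (cases lam)
      case (Cons v lam')
      have "\<forall>x\<in>set lam'. x < v" using that by (auto simp: Cons strict_partition_def)
      then have "filter (\<lambda>x. x > v) lam' = []" by (auto simp: filter_empty_conv)
      then show ?thesis using 1 \<open>\<forall>x\<in>set lam'. x < v\<close> by (auto simp: Cons)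
    qed simp
    then show ?thesis using schur_Q_in_schur_span[OF st, of a] schur_coord_schur_Q[OF _ st] 1
      by (simp add: schur_Q_Cons[of a] max_absorb1)
  next
    case 2
    have "distinct lam" if "strict_partition lam" for lam
      using that by (auto simp: strict_partition_def sorted_wrt_iff_nth_less distinct_conv_nth)
        (metis less_irrefl linorder_neqE_nat)
    then have "remove1 a lam \<noteq> b # eta" if "strict_partition lam" for lam
      using 2 that by (metis list.set_intros(1) set_remove1_eq Diff_iff singletonI)
    then show ?thesis using Q_op_square[OF assms(2)] 2 by (simp add: schur_Q_Cons)
  next
    case 3
    then have b: "b > 0" by simp
    have mx: "max a (first_part eta) \<le> b" "max a (first_part (b # eta)) = b" using 3 eta by auto
    note IH = Cons.IH[OF eta(1)]
    have E: "Q_op (int a) (schur_Q (b # eta)) = - Q_op (int b) (Q_op (int a) (schur_Q eta))"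
      unfolding schur_Q_Cons by (rule Q_op_anticommute[OF assms(2) b])
    have sp: "Q_op (int a) (schur_Q (b # eta)) \<in> schur_span b"
      unfolding E using Q_op_schur_span[OF IH[THEN conjunct1] mx(1) b] by (rule schur_span_uminus)
    have "schur_coord lam (Q_op (int a) (schur_Q (b # eta))) =
      (if a \<in> set lam \<and> remove1 a lam = b # eta then (-1) ^ length (filter (\<lambda>x. x > a) lam) else 0)"
      if lam: "strict_partition lam" for lam
    proof (cases lam)
      case Nil
      then show ?thesis
        unfolding E schur_coord_uminus schur_coord_Q_op[OF IH[THEN conjunct1] mx(1) b lam] by simp
    next
      case (Cons v lam')
      have lt: "\<forall>x\<in>set lam'. x < v" and st: "strict_partition lam'"
        using lam by (auto simp: Cons strict_partition_def)
      \<comment> \<open>If \<open>lam\<close> starts with \<open>a\<close>, its other parts are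
        below \<open>a < b\<close>, so removing \<open>a\<close> cannot leave
        \<open>b # eta\<close>.\<close>
      have "b \<notin> set lam'" if "v = a" using lt 3 that by auto
      then have "lam' \<noteq> b # eta" if "v = a" using that by auto
      then show ?thesis
        unfolding E schur_coord_uminus schur_coord_Q_op[OF IH[THEN conjunct1] mx(1) b lam]
        using IH[THEN conjunct2, rule_format, OF st] 3 by (auto simp: Cons)
    qed
    with sp show ?thesis unfolding mx(2) by blast
  qed
qed


section \<open>Horizontal strips\<close>

lemma diagram_Nil [simp]: "diagram [] = {}"
  by (auto simp: diagram_def)

lemma diagram_row_0 [simp]: "(0, j) \<notin> diagram xi"
  by (simp add: diagram_def)

lemma diagram_Cons: "diagram (n # xi) = {1} \<times> {1..n} \<union> map_prod Suc id ` diagram xi"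
proof -
  have "(i, j) \<in> diagram (n # xi) \<longleftrightarrow> (i, j) \<in> {1} \<times> {1..n} \<union> map_prod Suc id ` diagram xi" for i j
  proof (cases i)
    case (Suc i')
    then show ?thesis
      by (cases i') (auto simp: diagram_def part_def image_iff Bex_def)
  qed (auto simp: diagram_def)
  then show ?thesis by auto
qed

lemma in_diagram_Cons: "(Suc i, j) \<in> diagram (n # xi) \<longleftrightarrow> (i = 0 \<and> 1 \<le> j \<and> j \<le> n) \<or> (i, j) \<in> diagram xi"
  by (auto simp: diagram_Cons intro: image_eqI[of _ _ "(i, j)"])

lemma finite_diagram [simp]: "finite (diagram xi)"
  by (induction xi) (auto simp: diagram_Cons)

lemma card_diagram: "card (diagram xi) = sum_list xi"
proof (induction xi)
  case (Cons n xi)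
  have "card (diagram (n # xi)) = card ({1::nat} \<times> {1..n}) + card (map_prod Suc id ` diagram xi)"
    unfolding diagram_Cons by (rule card_Un_disjoint) auto
  also have "card (map_prod Suc id ` diagram xi) = sum_list xi"
    using Cons by (subst card_image) (auto simp: inj_on_def)
  finally show ?case by simp
qed simp

lemma diagram_column_le:
  assumes "strict_partition xi" "(i, j) \<in> diagram xi"
  shows "1 \<le> j" "j \<le> first_part xi"
proof -
  have "1 \<le> j \<and> j \<le> first_part xi" using assms
  proof (induction xi arbitrary: i)
    case (Cons n xi)
    have xi: "strict_partition xi" "first_part xi < n"
      using Cons.prems by (simp_all add: strict_partition_Cons)
    show ?case
    proof (cases i)
      case (Suc i')
      then consider "1 \<le> j" "j \<le> n" | "(i', j) \<in> diagram xi"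
        using Cons.prems by (auto simp: in_diagram_Cons)
      then show ?thesis
        by cases (use Cons.IH[OF xi(1), of i'] xi(2) in auto)
    qed (use Cons.prems in simp)
  qed simp
  then show "1 \<le> j" "j \<le> first_part xi" by auto
qed

lemma diagram_subset_Cons: "diagram (v # nu) \<subseteq> diagram (n # xi) \<longleftrightarrow> v \<le> n \<and> diagram nu \<subseteq> diagram xi"
proof
  assume s: "diagram (v # nu) \<subseteq> diagram (n # xi)"
  have "v \<le> n"
  proof (cases "v = 0")
    case False
    then have "(Suc 0, v) \<in> diagram (v # nu)" by (simp add: in_diagram_Cons)
    with s have "(Suc 0, v) \<in> diagram (n # xi)" by blast
    then show ?thesis by (simp add: in_diagram_Cons)
  qed simp
  moreover have "(i, j) \<in> diagram xi" if "(i, j) \<in> diagram nu" for i j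
  proof -
    have "i \<noteq> 0" using that by (cases i) auto
    moreover have "(Suc i, j) \<in> diagram (v # nu)" using that by (simp add: in_diagram_Cons)
    ultimately show ?thesis using subsetD[OF s, of "(Suc i, j)"] by (simp add: in_diagram_Cons)
  qed
  ultimately show "v \<le> n \<and> diagram nu \<subseteq> diagram xi" by auto
next
  assume "v \<le> n \<and> diagram nu \<subseteq> diagram xi"
  then show "diagram (v # nu) \<subseteq> diagram (n # xi)" by (auto simp: diagram_Cons)
qed

definition skew_column :: "nat list \<Rightarrow> nat list \<Rightarrow> nat \<Rightarrow> nat set"
  where "skew_column xi nu j = {i. (i, j) \<in> skew_diagram xi nu}"

lemma skew_column_Cons:
  "skew_column (n # xi) (v # nu) j = (if v < j \<and> j \<le> n then {1} else {}) \<union> Suc ` skew_column xi nu j"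
proof -
  have "i \<in> skew_column (n # xi) (v # nu) j \<longleftrightarrow>
    i \<in> (if v < j \<and> j \<le> n then {1} else {}) \<union> Suc ` skew_column xi nu j" for i
    by (cases i; cases "i - 1") (auto simp: skew_column_def skew_diagram_def in_diagram_Cons)
  then show ?thesis by auto
qed

lemma finite_skew_column [simp]: "finite (skew_column xi nu j)"
proof -
  have "skew_column xi nu j \<subseteq> fst ` diagram xi"
    by (force simp: skew_column_def skew_diagram_def)
  then show ?thesis by (rule finite_subset) simp
qed

lemma card_skew_column_Cons:
  "card (skew_column (n # xi) (v # nu) j) = (if v < j \<and> j \<le> n then 1 else 0) + card (skew_column xi nu j)"
proof -
  have "card (Suc ` skew_column xi nu j) = card (skew_column xi nu j)"
    by (rule card_image) simp
  moreover have "1 \<notin> Suc ` skew_column xi nu j"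
    by (auto simp: skew_column_def skew_diagram_def)
  ultimately show ?thesis by (auto simp: skew_column_Cons)
qed

lemma skew_column_le_first_part:
  assumes "strict_partition xi" "skew_column xi nu j \<noteq> {}"
  shows "1 \<le> j" "j \<le> first_part xi"
  using assms diagram_column_le by (auto simp: skew_column_def skew_diagram_def)

text \<open>The last box of the top row lies outside \<open>nu\<close>.\<close>

lemma skew_column_first_part:
  assumes "strict_partition nu" "first_part nu < first_part xi"
  shows "skew_column xi nu (first_part xi) \<noteq> {}"
proof -
  obtain m xi' where xi: "xi = m # xi'" using assms by (cases xi) auto
  have "(Suc 0, m) \<in> diagram xi" using assms xi by (simp add: in_diagram_Cons)
  moreover have "(Suc 0, m) \<notin> diagram nu"
    using diagram_column_le[OF assms(1), of "Suc 0" m] assms xi by auto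
  ultimately show ?thesis by (auto simp: skew_column_def skew_diagram_def xi)
qed

text \<open>If \<open>v < first_part xi\<close>, strictness of \<open>v # nu\<close> puts a box of
  the lower strip in column \<open>first_part xi\<close>, where the top row also has one. Otherwise
  the two strips occupy disjoint columns.\<close>

lemma horizontal_strip_Cons:
  assumes "strict_partition (n # xi)" "strict_partition (v # nu)"
  shows "horizontal_strip (n # xi) (v # nu) \<longleftrightarrow> v \<le> n \<and> first_part xi \<le> v \<and> horizontal_strip xi nu"
proof -
  have st: "strict_partition xi" "strict_partition nu" "first_part xi < n" "first_part nu < v"
    using assms by (auto simp: strict_partition_Cons)
  have "(\<forall>j. v < j \<and> j \<le> n \<longrightarrow> skew_column xi nu j = {}) \<longleftrightarrow> first_part xi \<le> v"
    using skew_column_first_part[OF st(2), of xi] skew_column_le_first_part[OF st(1)] st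
    by (metis le_trans less_imp_le_nat linorder_not_le order.strict_trans)
  moreover have "(\<forall>j. card (skew_column (n # xi) (v # nu) j) \<le> 1) \<longleftrightarrow>
     (\<forall>j. card (skew_column xi nu j) \<le> 1) \<and> (\<forall>j. v < j \<and> j \<le> n \<longrightarrow> skew_column xi nu j = {})"
    by (auto simp: card_skew_column_Cons)
  ultimately show ?thesis
    unfolding horizontal_strip_def diagram_subset_Cons skew_column_def[symmetric] by blast
qed

text \<open>The right ends of the maximal runs of consecutive columns.\<close>

definition strip_ends :: "nat set \<Rightarrow> nat set"
  where "strip_ends C = {j \<in> C. Suc j \<notin> C}"

lemma strip_a_eq:
  assumes "strict_partition xi"
  shows "strip_a xi nu = card (strip_ends {j. skew_column xi nu j \<noteq> {}})"
proof -
  have "{j. j \<ge> 1 \<and> (\<exists>i. (i, j) \<in> skew_diagram xi nu) \<and> \<not> (\<exists>i. (i, j + 1) \<in> skew_diagram xi nu)} =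
     strip_ends {j. skew_column xi nu j \<noteq> {}}"
    using skew_column_le_first_part(1)[OF assms, of nu]
    by (auto simp: strip_ends_def skew_column_def)
  then show ?thesis by (simp add: strip_a_def)
qed

text \<open>The top row adds the run \<open>{v<..n}\<close> to columns that are all at most
  \<open>first_part xi\<close>. It is empty if \<open>v = n\<close>, prolongs the last run if
  \<open>v = first_part xi\<close>, and is otherwise a new run, since column \<open>v\<close> is
  unoccupied.\<close>

lemma strip_a_Cons:
  assumes "strict_partition (n # xi)" "strict_partition (v # nu)" "v \<le> n" "first_part xi \<le> v"
  shows "strip_a (n # xi) (v # nu) = (if v = n \<or> v = first_part xi then 0 else 1) + strip_a xi nu"
proof -
  have st: "strict_partition xi" "strict_partition nu" "first_part xi < n" "first_part nu < v"
    using assms by (auto simp: strict_partition_Cons)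
  define C where "C = {j. skew_column xi nu j \<noteq> {}}"
  have C: "j \<le> first_part xi" if "j \<in> C" for j
    using that skew_column_le_first_part[OF st(1)] by (simp add: C_def)
  have fin: "finite (strip_ends C)"
    by (rule finite_subset[of _ "{..first_part xi}"]) (auto simp: strip_ends_def C)
  have a: "strip_a xi nu = card (strip_ends C)"
    by (simp add: strip_a_eq[OF st(1)] C_def)
  have "{j. skew_column (n # xi) (v # nu) j \<noteq> {}} = {v<..n} \<union> C"
    by (auto simp: skew_column_Cons C_def)
  then have a': "strip_a (n # xi) (v # nu) = card (strip_ends ({v<..n} \<union> C))"
    by (simp add: strip_a_eq[OF assms(1)])
  consider "v = n" | "v < n" "v = first_part xi" | "v < n" "first_part xi < v"
    using assms by linarith
  then show ?thesis
  proof cases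
    case 1
    then show ?thesis unfolding a a' by simp
  next
    case 2
    then have "v \<in> C" using skew_column_first_part[OF st(2), of xi] st by (simp add: C_def)
    then have v: "v \<in> strip_ends C" using C[of "Suc v"] 2 by (auto simp: strip_ends_def)
    have "strip_ends ({v<..n} \<union> C) = insert n (strip_ends C - {v})"
    proof (rule set_eqI)
      fix x show "x \<in> strip_ends ({v<..n} \<union> C) \<longleftrightarrow> x \<in> insert n (strip_ends C - {v})"
        using 2 C[of x] C[of "Suc x"] by (auto simp: strip_ends_def)
    qed
    moreover have "n \<notin> strip_ends C" using C[of n] 2 by (auto simp: strip_ends_def)
    ultimately show ?thesis unfolding a a' using card.remove[OF fin v] 2 fin by simp
  next
    case 3
    have "strip_ends ({v<..n} \<union> C) = insert n (strip_ends C)"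
    proof (rule set_eqI)
      fix x show "x \<in> strip_ends ({v<..n} \<union> C) \<longleftrightarrow> x \<in> insert n (strip_ends C)"
        using 3 C[of x] C[of "Suc x"] by (auto simp: strip_ends_def)
    qed
    moreover have "n \<notin> strip_ends C" using C[of n] 3 by (auto simp: strip_ends_def)
    ultimately show ?thesis unfolding a a' using fin 3 by simp
  qed
qed

text \<open>The recursion for weights matches those for strips and their ends row by row. Over the
  empty partition only one row is possible, forming a single run.\<close>

lemma strip_weight_eq:
  assumes "strict_partition xi" "strict_partition nu"
  shows "strip_weight xi nu = (if horizontal_strip xi nu then 2 ^ strip_a xi nu else 0)"
  using assms
proof (induction xi nu rule: strip_weight.induct)
  case 1
  then show ?case by (simp add: horizontal_strip_def strip_a_def skew_diagram_def)
next
  case (2 v nu)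
  then have "(Suc 0, v) \<in> diagram (v # nu)" by (auto simp: in_diagram_Cons strict_partition_Cons)
  then show ?case by (auto simp: horizontal_strip_def)
next
  case (3 n xi)
  have skew: "skew_diagram (n # xi) [] = diagram (n # xi)" by (simp add: skew_diagram_def)
  show ?case
  proof (cases xi)
    case Nil
    have n: "n > 0" using 3 by (simp add: strict_partition_Cons)
    have D: "(i, j) \<in> diagram [n] \<longleftrightarrow> i = 1 \<and> 1 \<le> j \<and> j \<le> n" for i j
      by (cases i) (auto simp: in_diagram_Cons)
    have "{j. j \<ge> 1 \<and> (\<exists>i. (i, j) \<in> diagram [n]) \<and> \<not> (\<exists>i. (i, j + 1) \<in> diagram [n])} = {n}"
      using n by (auto simp: D)
    then have "strip_a [n] [] = 1" using skew Nil by (simp add: strip_a_def)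
    moreover have "{i. (i, j) \<in> diagram [n]} \<subseteq> {1}" for j by (auto simp: D)
    then have "card {i. (i, j) \<in> diagram [n]} \<le> 1" for j
      using card_mono[of "{1::nat}" "{i. (i, j) \<in> diagram [n]}"] by simp
    then have "horizontal_strip [n] []" using skew Nil by (simp add: horizontal_strip_def)
    ultimately show ?thesis by (simp add: Nil)
  next
    case (Cons m xi')
    \<comment> \<open>Two nonempty rows both have a box in column 1.\<close>
    have "{Suc 0, Suc (Suc 0)} \<subseteq> {i. (i, 1) \<in> diagram (n # xi)}"
      using 3 by (auto simp: in_diagram_Cons strict_partition_Cons Cons)
    moreover have "finite {i. (i, 1) \<in> diagram (n # xi)}"
      using finite_skew_column[of "n # xi" "[]" 1] by (simp add: skew_column_def skew)
    ultimately have "card {Suc 0, Suc (Suc 0)} \<le> card {i. (i, 1) \<in> diagram (n # xi)}"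
      by (intro card_mono)
    then have "\<not> horizontal_strip (n # xi) []"
      by (auto simp: horizontal_strip_def skew intro!: exI[of _ 1])
    then show ?thesis by (simp add: Cons)
  qed
next
  case (4 n xi v nu)
  have st: "strict_partition xi" "strict_partition nu"
    using 4 by (auto simp: strict_partition_Cons)
  show ?case
  proof (cases "v \<le> n \<and> first_part xi \<le> v")
    case True
    then show ?thesis using 4 st by (simp add: horizontal_strip_Cons strip_a_Cons)
  next
    case False
    then show ?thesis using 4 by (auto simp: horizontal_strip_Cons)
  qed
qed

text \<open>The additive form avoids truncated subtraction and matches the degree condition on
  coordinates.\<close>

lemma card_skew_diagram:
  assumes "horizontal_strip xi nu"
  shows "card (skew_diagram xi nu) = k \<longleftrightarrow> sum_list nu + k = sum_list xi"
proof -
  have sub: "diagram nu \<subseteq> diagram xi" using assms by (simp add: horizontal_strip_def)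
  have "sum_list nu \<le> sum_list xi"
    using card_mono[OF _ sub] by (simp add: card_diagram)
  moreover have "card (skew_diagram xi nu) = sum_list xi - sum_list nu"
    unfolding skew_diagram_def using card_Diff_subset[OF _ sub] by (simp add: card_diagram)
  ultimately show ?thesis by auto
qed

text \<open>Needed because a sum over an infinite set defaults to 0.\<close>

lemma finite_strict_partitions: "finite {xi. strict_partition xi \<and> sum_list xi = s}"
proof -
  have "length xi \<le> sum_list xi" if "strict_partition xi" for xi
    using that by (induction xi) (auto simp: strict_partition_Cons)
  moreover have "x \<le> sum_list xi" if "x \<in> set xi" for x and xi :: "nat list"
    by (rule member_le_sum_list) (use that in simp_all)
  ultimately have "{xi. strict_partition xi \<and> sum_list xi = s} \<subseteq> {xi. set xi \<subseteq> {..s} \<and> length xi \<le> s}"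
    by auto
  then show ?thesis by (rule finite_subset) (simp add: finite_lists_length_le)
qed

section \<open>The operators on arbitrary elements of the span\<close>

lemma annih_schur_span:
  assumes "f \<in> schur_span m"
  shows "annih k f \<in> schur_span m"
  using assms
proof (induction f rule: schur_span_induct)
  case (schur_Q xi)
  then show ?case using annih_schur_Q_coord schur_span_mono by blast
qed (auto simp: annihilation_part_add annihilation_part_smul schur_span_add schur_span_smul)

lemma schur_coord_annih:
  assumes "f \<in> schur_span m" "strict_partition nu"
  shows "schur_coord nu (annih k f) =
    (\<Sum>xi | strict_partition xi \<and> sum_list nu + k = sum_list xi. strip_weight xi nu * schur_coord xi f)"
proof -
  have "{xi. strict_partition xi \<and> sum_list nu + k = sum_list xi} =
      {xi. strict_partition xi \<and> sum_list xi = sum_list nu + k}" by auto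
  then have fin: "finite {xi. strict_partition xi \<and> sum_list nu + k = sum_list xi}"
    by (simp add: finite_strict_partitions)
  show ?thesis using assms(1)
  proof (induction f rule: schur_span_induct)
    case (schur_Q eta)
    have "(\<Sum>xi | strict_partition xi \<and> sum_list nu + k = sum_list xi. strip_weight xi nu * schur_coord xi (schur_Q eta)) =
      (\<Sum>xi | strict_partition xi \<and> sum_list nu + k = sum_list xi. if xi = eta then strip_weight xi nu else 0)"
      using schur_Q by (intro sum.cong[OF refl]) (simp add: schur_coord_schur_Q)
    then show ?case using annih_schur_Q_coord[of eta k] schur_Q assms(2) fin by (simp add: sum.delta)
  qed (auto simp: annihilation_part_add annihilation_part_smul schur_coord_add schur_coord_smul
      sum.distrib sum_distrib_left distrib_left mult.left_commute)
qed

lemma Q_op_schur_span_max: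
  assumes "f \<in> schur_span m" "a > 0"
  shows "Q_op (int a) f \<in> schur_span (max a m)"
  using assms(1)
proof (induction f rule: schur_span_induct)
  case (schur_Q xi)
  then have "Q_op (int a) (schur_Q xi) \<in> schur_span (max a (first_part xi))"
    using Q_op_schur_Q_coord assms(2) by blast
  then show ?case by (rule schur_span_mono[rotated]) (use schur_Q in auto)
qed (auto simp: Q_op_add Q_op_smul schur_span_add schur_span_smul)

lemma strict_partition_remove1:
  assumes "strict_partition lam"
  shows "strict_partition (remove1 a lam)"
proof -
  have "sorted_wrt (>) (remove1 a lam)" if "sorted_wrt (>) lam" for lam :: "nat list"
    using that by (induction lam) (use set_remove1_subset in fastforce)+
  then show ?thesis using assms by (simp add: strict_partition_def)
qed

lemma schur_coord_Q_op_general: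
  assumes "f \<in> schur_span m" "strict_partition lam" "a > 0"
  shows "schur_coord lam (Q_op (int a) f) =
    (if a \<in> set lam then (-1) ^ length (filter (\<lambda>x. x > a) lam) * schur_coord (remove1 a lam) f else 0)"
  using assms(1)
proof (induction f rule: schur_span_induct)
  case (schur_Q eta)
  have "strict_partition (remove1 a lam)"
    using assms(2) by (rule strict_partition_remove1)
  then show ?case
    using Q_op_schur_Q_coord[OF schur_Q(1) assms(3)] assms(2) schur_Q(1) by (simp add: schur_coord_schur_Q)
qed (auto simp: Q_op_add Q_op_smul schur_coord_add schur_coord_smul distrib_left)

lemma G_op_schur_span:
  assumes "f \<in> schur_span m" "n > 0"
  shows "\<exists>M. G_op (int n) f \<in> schur_span M"
proof -
  obtain N where N: "\<forall>k>N. annih k f = 0"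
    using annihilation_part_eventually_0 by blast
  have "smul (t ^ k) (Q_op (int n + int k) (annih k f)) \<in> schur_span (max (n + N) m)" if "k \<le> N" for k
  proof -
    have "Q_op (int (n + k)) (annih k f) \<in> schur_span (max (n + k) m)"
      using assms by (intro Q_op_schur_span_max annih_schur_span) auto
    then have "Q_op (int (n + k)) (annih k f) \<in> schur_span (max (n + N) m)"
      by (rule schur_span_mono[rotated]) (use that in auto)
    then show ?thesis using schur_span_smul by simp
  qed
  then have "G_op (int n) f \<in> schur_span (max (n + N) m)"
    unfolding G_op_eq[OF N] schur_span_def by (intro gamma.span_sum) simp
  then show ?thesis by blast
qed

text \<open>Guarantees that the description defining \<open>Q_Kostka\<close> is satisfiable.\<close>

lemma hall_littlewood_G_schur_span:
  assumes "0 \<notin> set mu"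
  shows "\<exists>m. hall_littlewood_G mu \<in> schur_span m"
  using assms
proof (induction mu)
  case Nil
  then show ?case using schur_Q_in_schur_span[of "[]" 0] by (auto simp: hall_littlewood_G_def)
next
  case (Cons n mu)
  then show ?case using G_op_schur_span[of "hall_littlewood_G mu" _ n] by (auto simp: hall_littlewood_G_def)
qed

text \<open>In a strict partition the parts above the \<open>i\<close>-th are exactly the
  \<open>i - 1\<close> preceding it, which turns the insertion sign into
  \<open>(-1) ^ (i - 1)\<close>.\<close>

lemma remove_part_strict:
  assumes "strict_partition lam" "1 \<le> i" "i \<le> length lam"
  shows "remove1 (part lam i) lam = remove_part i lam"
    and "length (filter (\<lambda>x. x > part lam i) lam) = i - 1"
    and "strict_partition (remove_part i lam)"
proof -
  define p where "p = part lam i"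
  define xs where "xs = take (i - 1) lam"
  define ys where "ys = drop i lam"
  have lam: "lam = xs @ p # ys"
    using id_take_nth_drop[of "i - 1" lam] assms by (simp add: p_def part_def xs_def ys_def)
  have len: "length xs = i - 1" using assms by (simp add: xs_def)
  have s: "\<forall>x\<in>set xs. p < x" "\<forall>y\<in>set ys. y < p" "strict_partition (xs @ ys)"
    using assms(1) unfolding lam by (auto simp: strict_partition_def sorted_wrt_append)
  have r: "remove_part i lam = xs @ ys" by (simp add: remove_part_def xs_def ys_def)
  show "strict_partition (remove_part i lam)" using s r by simp
  have "p \<notin> set xs" using s by auto
  then show "remove1 (part lam i) lam = remove_part i lam"
    unfolding r p_def[symmetric] by (subst lam) (simp add: remove1_append)
  have "filter (\<lambda>x. x > p) xs = xs" "filter (\<lambda>x. x > p) ys = []"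
    using s by (auto simp: filter_id_conv filter_empty_conv)
  then show "length (filter (\<lambda>x. x > part lam i) lam) = i - 1"
    unfolding p_def[symmetric] len[symmetric] by (subst lam) simp
qed

lemma inj_on_part:
  assumes "strict_partition lam"
  shows "inj_on (part lam) {1..length lam}"
proof (rule linorder_inj_onI)
  fix i j assume "i < j" "i \<in> {1..length lam}" "j \<in> {1..length lam}"
  moreover from this have "i - 1 < j - 1" "j - 1 < length lam" by auto
  ultimately show "part lam i \<noteq> part lam j"
    using assms sorted_wrt_nth_less[of "(>)" lam "i - 1" "j - 1"] by (auto simp: strict_partition_def part_def)
qed auto

theorem theorem3p4:
  fixes n :: nat and lam mu :: "nat list"
  assumes "n \<ge> 1"
    and "strict_partition lam" and "sum_list lam = n"
    and "strict_partition mu" and "sum_list mu = n"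
  shows "Q_Kostka lam mu =
    (\<Sum>i | 1 \<le> i \<and> i \<le> length lam \<and> part lam i \<ge> part mu 1.
      \<Sum>xi | strict_partition xi \<and> horizontal_strip xi (remove_part i lam) \<and>
             card (skew_diagram xi (remove_part i lam)) = part lam i - part mu 1.
        (- 1) ^ (i - 1) * 2 ^ strip_a xi (remove_part i lam) *
        t ^ (part lam i - part mu 1) * Q_Kostka xi (remove_part 1 mu))"
proof -
  obtain m mu' where mu: "mu = m # mu'" using assms by (cases mu) auto
  have m: "part mu 1 = m" "remove_part 1 mu = mu'" "m > 0" "strict_partition mu'"
    using assms(4) by (auto simp: mu part_def remove_part_def strict_partition_Cons)
  define f where "f = hall_littlewood_G mu'"
  obtain M where f: "f \<in> schur_span M"
    using hall_littlewood_G_schur_span[of mu'] m(4) by (auto simp: f_def strict_partition_def)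
  obtain M' where Gmu: "hall_littlewood_G mu \<in> schur_span M'"
    using hall_littlewood_G_schur_span[of mu] assms(4) by (auto simp: strict_partition_def)
  have Kmu': "Q_Kostka xi mu' = schur_coord xi f" if "strict_partition xi" for xi
    using Q_Kostka_eq_schur_coord[OF _ that] f by (simp add: f_def)
  obtain N0 where N0: "\<forall>k>N0. annih k f = 0"
    using annihilation_part_eventually_0 by blast
  \<comment> \<open>The second bound ensures that every \<open>k\<close> for which
    \<open>m + k\<close> is a part of \<open>lam\<close> is in range.\<close>
  define N where "N = max N0 (sum_list lam)"
  have N: "\<forall>k>N. annih k f = 0" using N0 by (simp add: N_def)
  define I where "I = {i. 1 \<le> i \<and> i \<le> length lam \<and> part lam i \<ge> m}"
  define h where "h k = (if m + k \<in> set lam then t ^ k * ((-1) ^ length (filter (\<lambda>x. x > m + k) lam) *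
      schur_coord (remove1 (m + k) lam) (annih k f)) else 0)" for k
  \<comment> \<open>Parts are distinct, so the inserted part \<open>m + k\<close> determines the row
    \<open>i\<close>, with \<open>k = part lam i - m\<close>.\<close>
  have bij: "bij_betw (\<lambda>i. part lam i - m) I {k. k \<le> N \<and> m + k \<in> set lam}"
    unfolding bij_betw_def
  proof
    show "inj_on (\<lambda>i. part lam i - m) I"
      using inj_on_part[OF assms(2)] by (auto simp: I_def inj_on_def)
    show "(\<lambda>i. part lam i - m) ` I = {k. k \<le> N \<and> m + k \<in> set lam}"
    proof (intro equalityI subsetI)
      fix k assume "k \<in> (\<lambda>i. part lam i - m) ` I"
      then obtain i where i: "1 \<le> i" "i \<le> length lam" "part lam i \<ge> m" "k = part lam i - m"
        by (auto simp: I_def)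
      then have "part lam i \<in> set lam" by (simp add: part_def)
      moreover from member_le_sum_list[OF this] have "k \<le> N" using i by (simp add: N_def)
      ultimately show "k \<in> {k. k \<le> N \<and> m + k \<in> set lam}" using i by simp
    next
      fix k assume "k \<in> {k. k \<le> N \<and> m + k \<in> set lam}"
      then obtain j where "j < length lam" "lam ! j = m + k" by (auto simp: in_set_conv_nth)
      then show "k \<in> (\<lambda>i. part lam i - m) ` I"
        by (intro image_eqI[of _ _ "Suc j"]) (auto simp: I_def part_def)
    qed
  qed
  have "Q_Kostka lam mu = schur_coord lam (G_op (int m) f)"
    using Q_Kostka_eq_schur_coord[OF Gmu assms(2)] by (simp add: mu f_def hall_littlewood_G_def)
  also have "\<dots> = (\<Sum>k\<le>N. t ^ k * schur_coord lam (Q_op (int (m + k)) (annih k f)))"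
    by (simp add: G_op_eq[OF N] schur_coord_sum schur_coord_smul)
  also have "\<dots> = (\<Sum>k\<le>N. h k)"
    using m by (simp add: schur_coord_Q_op_general[OF annih_schur_span[OF f] assms(2)] h_def if_distrib del: of_nat_add cong: if_cong)
  also have "\<dots> = (\<Sum>k | k \<le> N \<and> m + k \<in> set lam. h k)"
    by (rule sum.mono_neutral_right) (auto simp: h_def)
  also have "\<dots> = (\<Sum>i\<in>I. h (part lam i - m))"
    by (rule sum.reindex_bij_betw[OF bij, symmetric])
  also have "\<dots> = (\<Sum>i\<in>I. \<Sum>xi | strict_partition xi \<and> horizontal_strip xi (remove_part i lam) \<and>
             card (skew_diagram xi (remove_part i lam)) = part lam i - m.
        (- 1) ^ (i - 1) * 2 ^ strip_a xi (remove_part i lam) * t ^ (part lam i - m) * Q_Kostka xi mu')"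
  proof (rule sum.cong[OF refl])
    fix i assume "i \<in> I"
    then have i: "1 \<le> i" "i \<le> length lam" "m \<le> part lam i" by (auto simp: I_def)
    define k where "k = part lam i - m"
    define nu where "nu = remove_part i lam"
    have mk: "m + k = part lam i" using i by (simp add: k_def)
    note r = remove_part_strict[OF assms(2) i(1,2), folded nu_def]
    have fin: "finite {xi. strict_partition xi \<and> sum_list nu + k = sum_list xi}"
      using finite_strict_partitions[of "sum_list nu + k"] by (simp add: eq_commute)
    have "part lam i \<in> set lam" using i by (simp add: part_def)
    then have "h k = t ^ k * ((-1) ^ (i - 1) * schur_coord nu (annih k f))"
      unfolding h_def mk r(1,2) by simp
    also have "\<dots> = (\<Sum>xi | strict_partition xi \<and> sum_list nu + k = sum_list xi.
        (- 1) ^ (i - 1) * strip_weight xi nu * t ^ k * schur_coord xi f)"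
      unfolding schur_coord_annih[OF f r(3)] sum_distrib_left by (simp add: ac_simps)
    \<comment> \<open>Weights vanish off horizontal strips, and the coordinates of \<open>f\<close>
      become \<open>Q_Kostka\<close> at strict \<open>xi\<close>.\<close>
    also have "\<dots> = (\<Sum>xi | strict_partition xi \<and> horizontal_strip xi nu \<and> sum_list nu + k = sum_list xi.
        (- 1) ^ (i - 1) * 2 ^ strip_a xi nu * t ^ k * Q_Kostka xi mu')"
      by (rule sum.mono_neutral_cong_right[OF fin])
        (auto simp: strip_weight_eq[OF _ r(3)] Kmu' split: if_splits)
    also have "{xi. strict_partition xi \<and> horizontal_strip xi nu \<and> sum_list nu + k = sum_list xi} =
        {xi. strict_partition xi \<and> horizontal_strip xi nu \<and> card (skew_diagram xi nu) = k}"
      using card_skew_diagram by blast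
    finally show "h (part lam i - m) = (\<Sum>xi | strict_partition xi \<and> horizontal_strip xi (remove_part i lam) \<and>
             card (skew_diagram xi (remove_part i lam)) = part lam i - m.
        (- 1) ^ (i - 1) * 2 ^ strip_a xi (remove_part i lam) * t ^ (part lam i - m) * Q_Kostka xi mu')"
      unfolding k_def nu_def .
  qed
  finally show ?thesis unfolding I_def m(1,2) .
qed

end
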